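(* Every proper equivalence class of $(n,r)$-weighing matrices in which any two distinct rows intersect in $0$ or $2$ places uniquely determines a switching isomorphism class of bipartite $(2n,r)$-SR2SEs, namely the class of the signed graph with adjacency matrix $\begin{bmatrix} O & M^\top\\ M & O\end{bmatrix}$ for $M$ in the given equivalence class; and vice versa.
   Context: An $(n,r)$-weighing matrix is an $n\times n$ matrix $M$ with entries in $\{0,\pm1\}$ with $M^\top M=rI$. Two rows intersect in $k$ places if the supports of their nonzero entries share exactly $k$ positions. Weighing matrices $M,N$ are equivalent if $M=PNQ$ for signed permutation matrices $P,Q$ ($\{0,\pm1\}$-matrices with exactly one nonzero entry in each row and column). A weighing matrix is proper if it is not equivalent to a direct sum of two weighing matrices; an equivalence class is proper if it contains a proper weighing matrix. A signed graph $\dot G=(G,\sigma)$ consists of a simple graph $G$ and $\sigma:E(G)\to\{1,-1\}$, with adjacency matrix that of $G$ with entries of negative edges replaced by $-1$; it is bipartite if $G$ is. A signed $(0,2)$-graph is a connected signed graph in which any two distinct vertices have $0$ or $2$ common neighbours; a signed rectagraph is a triangle-free one. An SR2SE is a signed rectagraph whose spectrum consists of exactly two distinct eigenvalues $\pm\lambda$; a $(2n,r)$-SR2SE has $2n$ vertices and is $r$-regular. Signed graphs are switching isomorphic if their adjacency matrices $A,B$ satisfy $B=Q^\top AQ$ for a signed permutation matrix $Q$.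
   Formalization: In the "vice versa" part, a switching isomorphism class determines the proper equivalence class only up to transposition (M and its transpose give the same signed graph class but need not be equivalent); n and r are taken positive. *)

theory Defs
  imports
    "Jordan_Normal_Form.Spectral_Radius"
    "HOL-Library.Infinite_Typeclass"
begin

definition weighing_matrix :: "nat \<Rightarrow> nat \<Rightarrow> real mat \<Rightarrow> bool" where
  "weighing_matrix n r M \<longleftrightarrow>
     M \<in> carrier_mat n n \<and>
     (\<forall>i<n. \<forall>j<n. M $$ (i, j) \<in> {0, 1, -1}) \<and>
     transpose_mat M * M = real r \<cdot>\<^sub>m 1\<^sub>m n"

definition row_support :: "real mat \<Rightarrow> nat \<Rightarrow> nat set" where
  "row_support M i = {j. j < dim_col M \<and> M $$ (i, j) \<noteq> 0}"

definition rows_intersect_0_or_2 :: "real mat \<Rightarrow> bool" where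
  "rows_intersect_0_or_2 M \<longleftrightarrow>
     (\<forall>i<dim_row M. \<forall>j<dim_row M. i \<noteq> j \<longrightarrow>
        card (row_support M i \<inter> row_support M j) \<in> {0, 2})"

definition signed_permutation_matrix :: "nat \<Rightarrow> real mat \<Rightarrow> bool" where
  "signed_permutation_matrix n P \<longleftrightarrow>
     P \<in> carrier_mat n n \<and>
     (\<forall>i<n. \<forall>j<n. P $$ (i, j) \<in> {0, 1, -1}) \<and>
     (\<forall>i<n. \<exists>!j. j < n \<and> P $$ (i, j) \<noteq> 0) \<and>
     (\<forall>j<n. \<exists>!i. i < n \<and> P $$ (i, j) \<noteq> 0)"

definition weighing_equivalent :: "nat \<Rightarrow> real mat \<Rightarrow> real mat \<Rightarrow> bool" where
  "weighing_equivalent n M N \<longleftrightarrow>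
     (\<exists>P Q. signed_permutation_matrix n P \<and> signed_permutation_matrix n Q \<and> M = P * N * Q)"

definition direct_sum_mat :: "real mat \<Rightarrow> real mat \<Rightarrow> real mat" where
  "direct_sum_mat A B =
     four_block_mat A (0\<^sub>m (dim_row A) (dim_col B)) (0\<^sub>m (dim_row B) (dim_col A)) B"

text \<open>Both summands of a direct sum have positive size; otherwise no matrix would be proper.\<close>

definition proper_weighing_matrix :: "nat \<Rightarrow> nat \<Rightarrow> real mat \<Rightarrow> bool" where
  "proper_weighing_matrix n r M \<longleftrightarrow>
     weighing_matrix n r M \<and>
     \<not> (\<exists>n1 r1 n2 r2 A B. 0 < n1 \<and> 0 < n2 \<and> n = n1 + n2 \<and>
          weighing_matrix n1 r1 A \<and> weighing_matrix n2 r2 B \<and>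
          weighing_equivalent n M (direct_sum_mat A B))"

definition weighing_classes :: "nat \<Rightarrow> nat \<Rightarrow> real mat set set" where
  "weighing_classes n r =
     {M. weighing_matrix n r M} //
     {(M, N). weighing_matrix n r M \<and> weighing_matrix n r N \<and> weighing_equivalent n M N}"

definition proper_weighing_classes_02 :: "nat \<Rightarrow> nat \<Rightarrow> real mat set set" where
  "proper_weighing_classes_02 n r =
     {C \<in> weighing_classes n r.
        (\<exists>M\<in>C. proper_weighing_matrix n r M) \<and> (\<forall>M\<in>C. rows_intersect_0_or_2 M)}"

text \<open>The values of \<open>sign\<close> outside the edge set carry no information: they enter neither the
  adjacency matrices nor any notion below.\<close>

record 'a sgraph =
  verts :: "'a set"
  edges :: "'a set set"
  sign :: "'a set \<Rightarrow> real"

definition signed_graph :: "'a sgraph \<Rightarrow> bool" where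
  "signed_graph G \<longleftrightarrow>
     finite (verts G) \<and>
     (\<forall>e\<in>edges G. e \<subseteq> verts G \<and> card e = 2) \<and>
     (\<forall>e\<in>edges G. sign G e \<in> {1, -1})"

text \<open>A graph has one adjacency matrix for every listing of its vertices; they are all
  permutation similar, so the spectrum below does not depend on the listing.\<close>

definition adj_mat_of_list :: "'a sgraph \<Rightarrow> 'a list \<Rightarrow> real mat" where
  "adj_mat_of_list G vs =
     mat (length vs) (length vs)
       (\<lambda>(i, j). if {vs ! i, vs ! j} \<in> edges G then sign G {vs ! i, vs ! j} else 0)"

definition adjacency_matrix :: "'a sgraph \<Rightarrow> real mat \<Rightarrow> bool" where
  "adjacency_matrix G A \<longleftrightarrow>
     (\<exists>vs. distinct vs \<and> set vs = verts G \<and> A = adj_mat_of_list G vs)"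

definition sgraph_spectrum :: "'a sgraph \<Rightarrow> real set" where
  "sgraph_spectrum G = (\<Union>A\<in>{A. adjacency_matrix G A}. spectrum A)"

definition neighbours :: "'a sgraph \<Rightarrow> 'a \<Rightarrow> 'a set" where
  "neighbours G u = {v \<in> verts G. {u, v} \<in> edges G}"

definition connected_sgraph :: "'a sgraph \<Rightarrow> bool" where
  "connected_sgraph G \<longleftrightarrow>
     verts G \<noteq> {} \<and>
     (\<forall>u\<in>verts G. \<forall>v\<in>verts G. (u, v) \<in> {(x, y). {x, y} \<in> edges G}\<^sup>*)"

definition bipartite_sgraph :: "'a sgraph \<Rightarrow> bool" where
  "bipartite_sgraph G \<longleftrightarrow>
     (\<exists>X Y. X \<union> Y = verts G \<and> X \<inter> Y = {} \<and> (\<forall>e\<in>edges G. \<exists>x\<in>X. \<exists>y\<in>Y. e = {x, y}))"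

definition regular_sgraph :: "nat \<Rightarrow> 'a sgraph \<Rightarrow> bool" where
  "regular_sgraph r G \<longleftrightarrow> (\<forall>v\<in>verts G. card (neighbours G v) = r)"

definition signed_02_graph :: "'a sgraph \<Rightarrow> bool" where
  "signed_02_graph G \<longleftrightarrow>
     signed_graph G \<and> connected_sgraph G \<and>
     (\<forall>u\<in>verts G. \<forall>v\<in>verts G. u \<noteq> v \<longrightarrow> card (neighbours G u \<inter> neighbours G v) \<in> {0, 2})"

definition triangle_free :: "'a sgraph \<Rightarrow> bool" where
  "triangle_free G \<longleftrightarrow>
     \<not> (\<exists>u v w. {u, v} \<in> edges G \<and> {v, w} \<in> edges G \<and> {u, w} \<in> edges G)"

definition signed_rectagraph :: "'a sgraph \<Rightarrow> bool" where
  "signed_rectagraph G \<longleftrightarrow> signed_02_graph G \<and> triangle_free G"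

definition SR2SE :: "nat \<Rightarrow> nat \<Rightarrow> 'a sgraph \<Rightarrow> bool" where
  "SR2SE m r G \<longleftrightarrow>
     signed_rectagraph G \<and>
     (\<exists>\<theta>. \<theta> \<noteq> -\<theta> \<and> sgraph_spectrum G = {\<theta>, -\<theta>}) \<and>
     card (verts G) = m \<and> regular_sgraph r G"

definition switching_isomorphic :: "'a sgraph \<Rightarrow> 'a sgraph \<Rightarrow> bool" where
  "switching_isomorphic G H \<longleftrightarrow>
     (\<exists>A B Q. adjacency_matrix G A \<and> adjacency_matrix H B \<and>
        signed_permutation_matrix (dim_row A) Q \<and> B = transpose_mat Q * A * Q)"

definition bipartite_SR2SE_classes :: "nat \<Rightarrow> nat \<Rightarrow> 'a sgraph set set" where
  "bipartite_SR2SE_classes m r =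
     {G. SR2SE m r G \<and> bipartite_sgraph G} //
     {(G, H). SR2SE m r G \<and> bipartite_sgraph G \<and> SR2SE m r H \<and> bipartite_sgraph H \<and>
        switching_isomorphic G H}"

definition bipartite_adj_mat :: "real mat \<Rightarrow> real mat" where
  "bipartite_adj_mat M =
     four_block_mat (0\<^sub>m (dim_col M) (dim_col M)) (transpose_mat M)
                    M (0\<^sub>m (dim_row M) (dim_row M))"

text \<open>\<open>S\<close> is the class of the signed graph with adjacency matrix \<^term>\<open>bipartite_adj_mat M\<close>, for
  every \<open>M\<close> in the class \<open>C\<close>. Graphs sharing an adjacency matrix are switching isomorphic, so it does
  not matter which of them is taken.\<close>

definition class_of_bipartite_graphs :: "real mat set \<Rightarrow> 'a sgraph set \<Rightarrow> bool" where
  "class_of_bipartite_graphs C S \<longleftrightarrow>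
     (\<forall>M\<in>C. \<exists>G\<in>S. adjacency_matrix G (bipartite_adj_mat M))"

text \<open>Listing the two colour classes of the graph in the opposite order replaces \<open>M\<close> by its
  transpose. Since \<^const>\<open>weighing_equivalent\<close> does not identify a matrix with its transpose, a
  switching class determines an equivalence class of weighing matrices only up to transposition.\<close>

end

theory Submission
  imports Defs
begin

text \<open>A matrix \<open>M\<close> and the bipartite signed graph with biadjacency matrix \<open>M\<close> carry the same data.
  If \<open>M\<^sup>T M = r I\<close>, the adjacency matrix \<open>A\<close> satisfies \<open>A\<^sup>2 = r I\<close>, hence has spectrum
  \<open>{\<surd>r, -\<surd>r}\<close>; conversely a symmetric \<open>A\<close> with spectrum \<open>{\<theta>, -\<theta>}\<close> satisfies
  \<open>A\<^sup>2 = \<theta>\<^sup>2 I\<close>, and the diagonal gives \<open>\<theta>\<^sup>2 = r\<close>. A direct sum decomposition of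
  \<open>M\<close> is a splitting of the graph into two parts without edges between them: such parts contain
  equally many rows and columns because every row and column has \<open>r\<close> nonzero entries. Since the
  graph of \<open>M\<close> is connected, a switching isomorphism either preserves its colour classes, and is
  then an equivalence of weighing matrices, or exchanges them, which transposes the matrix.\<close>

section \<open>Signed permutations of rows and columns\<close>

text \<open>The matrix condition speaks of rows only, whereas the graph needs 0 or 2 common
  neighbours for pairs of columns too. The signs settle this: row orthogonality caps the overlap of
  two columns at 2, and column orthogonality excludes 1. Properness is a negated existence statement
  over block sizes and over all equivalent matrices. It is replaced by the absence of nontrivial
  \<open>splits\<close>, a criterion that mentions one matrix only, is symmetric under
  transposition, and reads directly as connectedness of the graph. In the converse the spectrum is
  given as a set, without multiplicities. This suffices because opposite eigenvalues have equal
  squares, so the traces of \<open>A^2\<close> and \<open>A^4\<close> are determined;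
  \<open>A\<close> itself is never diagonalised. Neither colour class of a graph is distinguished,
  so a switching class can only return a matrix class together with its transposes. The vertex type
  is infinite so that every matrix is the adjacency matrix of some graph over it.\<close>

lemma index_mult_mat_sum:
  assumes "A \<in> carrier_mat n m" "B \<in> carrier_mat m k" "i < n" "j < k"
  shows "(A * B) $$ (i, j) = (\<Sum>l<m. A $$ (i, l) * B $$ (l, j))"
  using assms by (auto simp: scalar_prod_def atLeast0LessThan intro!: sum.cong)

lemma signed_permutation_matrix_transpose:
  assumes "signed_permutation_matrix n P"
  shows "signed_permutation_matrix n (transpose_mat P)"
proof -
  have "P \<in> carrier_mat n n" using assms by (simp add: signed_permutation_matrix_def)
  then have [simp]: "transpose_mat P $$ (i, j) = P $$ (j, i)" if "i < n" "j < n" for i j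
    using that by simp
  from \<open>P \<in> _\<close> assms show ?thesis
    unfolding signed_permutation_matrix_def by (simp cong: conj_cong)
qed

text \<open>Left factors are read by rows and right factors, below, by columns. In
  \<open>P * N * Q\<close> the functions \<open>p\<close> and \<open>q\<close> then index into
  \<open>N\<close> directly, and no inverse permutation appears.\<close>

lemma signed_permutation_matrixE_row:
  assumes "signed_permutation_matrix n P"
  obtains p s where "bij_betw p {..<n} {..<n}" "s \<in> {..<n} \<rightarrow> {1, -1}"
    "\<And>i j. i < n \<Longrightarrow> j < n \<Longrightarrow> P $$ (i, j) = (if j = p i then s i else 0)"
proof -
  have ent: "P $$ (i, j) \<in> {0, 1, -1}" if "i < n" "j < n" for i j
    using assms that by (simp add: signed_permutation_matrix_def)
  have row: "\<exists>!j. j < n \<and> P $$ (i, j) \<noteq> 0" if "i < n" for i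
    using assms that by (simp add: signed_permutation_matrix_def)
  have col: "\<exists>!i. i < n \<and> P $$ (i, j) \<noteq> 0" if "j < n" for j
    using assms that by (simp add: signed_permutation_matrix_def)
  from row obtain p where p: "\<And>i. i < n \<Longrightarrow> p i < n" "\<And>i. i < n \<Longrightarrow> P $$ (i, p i) \<noteq> 0"
    by metis
  have p_eq: "j = p i" if "i < n" "j < n" "P $$ (i, j) \<noteq> 0" for i j
    using row[OF that(1)] p[OF that(1)] that(2,3) by blast
  have "inj_on p {..<n}"
  proof (rule inj_onI)
    fix i k assume "i \<in> {..<n}" "k \<in> {..<n}" and eq: "p i = p k"
    then have ik: "i < n" "k < n" by simp_all
    show "i = k" using col[OF p(1)[OF ik(1)]] ik p(2)[OF ik(1)] p(2)[OF ik(2)] eq by metis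
  qed
  moreover have "p ` {..<n} \<subseteq> {..<n}" using p(1) by (simp add: image_subset_iff)
  ultimately have "bij_betw p {..<n} {..<n}"
    by (simp add: bij_betw_def endo_inj_surj)
  moreover have "(\<lambda>i. P $$ (i, p i)) \<in> {..<n} \<rightarrow> {1, -1}"
  proof
    fix i assume "i \<in> {..<n}"
    then show "P $$ (i, p i) \<in> {1, -1}" using ent[of i "p i"] p[of i] by simp
  qed
  moreover have "P $$ (i, j) = (if j = p i then P $$ (i, p i) else 0)" if "i < n" "j < n" for i j
    using p_eq[OF that] by metis
  ultimately show thesis by (rule that)
qed

lemma signed_permutation_matrixE_col:
  assumes "signed_permutation_matrix n P"
  obtains p s where "bij_betw p {..<n} {..<n}" "s \<in> {..<n} \<rightarrow> {1, -1}"
    "\<And>i j. i < n \<Longrightarrow> j < n \<Longrightarrow> P $$ (i, j) = (if i = p j then s j else 0)"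
proof -
  have P: "P \<in> carrier_mat n n" using assms by (simp add: signed_permutation_matrix_def)
  obtain p s where "bij_betw p {..<n} {..<n}" "s \<in> {..<n} \<rightarrow> {1, -1}" and
    "\<And>i j. i < n \<Longrightarrow> j < n \<Longrightarrow> transpose_mat P $$ (i, j) = (if j = p i then s i else 0)"
    by (rule signed_permutation_matrixE_row[OF signed_permutation_matrix_transpose[OF assms]]) blast
  then show thesis using that[of p s] P by auto
qed

lemma signed_permutation_matrix_row:
  assumes "bij_betw p {..<n} {..<n}" "s \<in> {..<n} \<rightarrow> {1, -1}"
  shows "signed_permutation_matrix n (mat n n (\<lambda>(i, j). if j = p i then s i else 0))"
proof -
  have s: "s i = 1 \<or> s i = -1" if "i < n" for i using assms(2) that by auto
  then have s0: "s i \<noteq> 0" if "i < n" for i using that by fastforce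
  have p: "p i < n" if "i < n" for i using assms(1) that by (auto dest: bij_betwE)
  have inj: "i = k" if "i < n" "k < n" "p i = p k" for i k
    using assms(1) that by (auto simp: bij_betw_def inj_on_def)
  have "\<exists>i<n. p i = j" if "j < n" for j
    using bij_betw_imp_surj_on[OF assms(1)] that by (metis imageE lessThan_iff)
  note col = this
  let ?P = "mat n n (\<lambda>(i, j). if j = p i then s i else 0)"
  have nz: "?P $$ (i, j) \<noteq> 0 \<longleftrightarrow> j = p i" if "i < n" "j < n" for i j
    using that s0 by simp
  show ?thesis
    unfolding signed_permutation_matrix_def
  proof (intro conjI allI impI)
    fix i assume i: "i < n"
    show "\<exists>!j. j < n \<and> ?P $$ (i, j) \<noteq> 0"
      using i nz p by (intro ex1I[of _ "p i"]) blast+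
  next
    fix j assume j: "j < n"
    then obtain i where "i < n" "p i = j" using col by blast
    then show "\<exists>!i. i < n \<and> ?P $$ (i, j) \<noteq> 0"
      using j nz inj by (intro ex1I[of _ i]) blast+
  qed (use s in auto)
qed

lemma signed_permutation_matrix_col:
  assumes "bij_betw p {..<n} {..<n}" "s \<in> {..<n} \<rightarrow> {1, -1}"
  shows "signed_permutation_matrix n (mat n n (\<lambda>(i, j). if i = p j then s j else 0))"
proof -
  have "transpose_mat (mat n n (\<lambda>(i, j). if j = p i then s i else 0)) =
      mat n n (\<lambda>(i, j). if i = p j then s j else 0)"
    by (rule eq_matI) auto
  then show ?thesis
    using signed_permutation_matrix_transpose[OF signed_permutation_matrix_row[OF assms]] by simp
qed

lemma index_monomial_mult:
  assumes "N \<in> carrier_mat n n" "P \<in> carrier_mat n n" "Q \<in> carrier_mat n n"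
    and p: "\<And>i. i < n \<Longrightarrow> p i < n" and q: "\<And>i. i < n \<Longrightarrow> q i < n"
    and P: "\<And>i j. i < n \<Longrightarrow> j < n \<Longrightarrow> P $$ (i, j) = (if j = p i then s i else 0)"
    and Q: "\<And>i j. i < n \<Longrightarrow> j < n \<Longrightarrow> Q $$ (i, j) = (if i = q j then t j else 0)"
    and ij: "i < n" "j < n"
  shows "(P * N * Q) $$ (i, j) = s i * t j * (N $$ (p i, q j) :: real)"
proof -
  have PN: "(P * N) $$ (i, l) = s i * N $$ (p i, l)" if "l < n" for l
  proof -
    have "(P * N) $$ (i, l) = (\<Sum>k<n. P $$ (i, k) * N $$ (k, l))"
      using assms that by (intro index_mult_mat_sum) auto
    also have "\<dots> = (\<Sum>k<n. if k = p i then s i * N $$ (p i, l) else 0)"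
      using P ij by (intro sum.cong) auto
    finally show ?thesis using p[OF ij(1)] by simp
  qed
  have "(P * N * Q) $$ (i, j) = (\<Sum>l<n. (P * N) $$ (i, l) * Q $$ (l, j))"
    using assms by (intro index_mult_mat_sum) auto
  also have "\<dots> = (\<Sum>l<n. if l = q j then s i * N $$ (p i, q j) * t j else 0)"
    using Q ij PN by (intro sum.cong) auto
  finally show ?thesis using q[OF ij(2)] by simp
qed

lemma weighing_equivalent_iff:
  assumes N: "N \<in> carrier_mat n n"
  shows "weighing_equivalent n M N \<longleftrightarrow> M \<in> carrier_mat n n \<and>
    (\<exists>p q s t. bij_betw p {..<n} {..<n} \<and> bij_betw q {..<n} {..<n} \<and>
       s \<in> {..<n} \<rightarrow> {1, -1} \<and> t \<in> {..<n} \<rightarrow> {1, -1} \<and>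
       (\<forall>i<n. \<forall>j<n. M $$ (i, j) = s i * t j * N $$ (p i, q j)))"
    (is "?L \<longleftrightarrow> ?R")
proof
  assume ?L
  then obtain P Q where PQ: "signed_permutation_matrix n P" "signed_permutation_matrix n Q"
    and M: "M = P * N * Q" by (auto simp: weighing_equivalent_def)
  have car: "P \<in> carrier_mat n n" "Q \<in> carrier_mat n n"
    using PQ by (simp_all add: signed_permutation_matrix_def)
  obtain p s where p: "bij_betw p {..<n} {..<n}" "s \<in> {..<n} \<rightarrow> {1, -1}"
    "\<And>i j. i < n \<Longrightarrow> j < n \<Longrightarrow> P $$ (i, j) = (if j = p i then s i else 0)"
    using signed_permutation_matrixE_row[OF PQ(1)] by blast
  obtain q t where q: "bij_betw q {..<n} {..<n}" "t \<in> {..<n} \<rightarrow> {1, -1}"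
    "\<And>i j. i < n \<Longrightarrow> j < n \<Longrightarrow> Q $$ (i, j) = (if i = q j then t j else 0)"
    using signed_permutation_matrixE_col[OF PQ(2)] by blast
  have lt: "p i < n" "q i < n" if "i < n" for i using p(1) q(1) that by (auto dest: bij_betwE)
  have "\<forall>i<n. \<forall>j<n. M $$ (i, j) = s i * t j * N $$ (p i, q j)"
    unfolding M using index_monomial_mult[OF N car lt p(3) q(3)] by (intro allI impI)
  moreover have "M \<in> carrier_mat n n" using car N M by auto
  ultimately show ?R using p(1,2) q(1,2)
    by (intro conjI exI[of _ p] exI[of _ q] exI[of _ s] exI[of _ t])
next
  assume ?R
  then obtain p q s t where M: "M \<in> carrier_mat n n"
    and p: "bij_betw p {..<n} {..<n}" "s \<in> {..<n} \<rightarrow> {1, -1}"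
    and q: "bij_betw q {..<n} {..<n}" "t \<in> {..<n} \<rightarrow> {1, -1}"
    and eq: "\<forall>i<n. \<forall>j<n. M $$ (i, j) = s i * t j * N $$ (p i, q j)"
    by (elim conjE exE) (rule that)
  define P where "P = mat n n (\<lambda>(i, j). if j = p i then s i else 0)"
  define Q where "Q = mat n n (\<lambda>(i, j). if i = q j then t j else 0)"
  have car: "P \<in> carrier_mat n n" "Q \<in> carrier_mat n n" by (auto simp: P_def Q_def)
  have lt: "p i < n" "q i < n" if "i < n" for i using p(1) q(1) that by (auto dest: bij_betwE)
  have "(P * N * Q) $$ (i, j) = M $$ (i, j)" if "i < n" "j < n" for i j
    using index_monomial_mult[OF N car, of p q s t i j] that lt eq by (simp add: P_def Q_def)
  then have "M = P * N * Q" using M car by (intro eq_matI) auto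
  then show ?L
    using signed_permutation_matrix_row[OF p] signed_permutation_matrix_col[OF q]
    unfolding weighing_equivalent_def P_def[symmetric] Q_def[symmetric]
    by (intro exI[of _ P] exI[of _ Q] conjI)
qed

lemma weighing_equivalentI:
  assumes "M \<in> carrier_mat n n" "N \<in> carrier_mat n n"
    "bij_betw p {..<n} {..<n}" "bij_betw q {..<n} {..<n}"
    "s \<in> {..<n} \<rightarrow> {1, -1}" "t \<in> {..<n} \<rightarrow> {1, -1}"
    "\<And>i j. i < n \<Longrightarrow> j < n \<Longrightarrow> M $$ (i, j) = s i * t j * N $$ (p i, q j)"
  shows "weighing_equivalent n M N"
  unfolding weighing_equivalent_iff[OF assms(2)]
  by (intro conjI exI[of _ p] exI[of _ q] exI[of _ s] exI[of _ t] allI impI assms)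

lemma weighing_equivalentE:
  assumes "weighing_equivalent n M N" "N \<in> carrier_mat n n"
  obtains p q s t where "M \<in> carrier_mat n n"
    "bij_betw p {..<n} {..<n}" "bij_betw q {..<n} {..<n}"
    "s \<in> {..<n} \<rightarrow> {1, -1}" "t \<in> {..<n} \<rightarrow> {1, -1}"
    "\<forall>i<n. \<forall>j<n. M $$ (i, j) = s i * t j * N $$ (p i, q j)"
  using assms(1) unfolding weighing_equivalent_iff[OF assms(2)]
  by (elim conjE exE) (rule that)

text \<open>The entrywise form of \<open>B = transpose_mat Q * A * Q\<close> for a signed
  permutation matrix \<open>Q\<close>. The carriers are part of the relation so that it also
  determines the order of both matrices; this is used later to equate vertex counts.\<close>

definition switching_equiv :: "nat \<Rightarrow> real mat \<Rightarrow> real mat \<Rightarrow> bool" where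
  "switching_equiv m A B \<longleftrightarrow> A \<in> carrier_mat m m \<and> B \<in> carrier_mat m m \<and>
     (\<exists>p s. bij_betw p {..<m} {..<m} \<and> s \<in> {..<m} \<rightarrow> {1, -1} \<and>
       (\<forall>i<m. \<forall>j<m. B $$ (i, j) = s i * s j * A $$ (p i, p j)))"

lemma switching_equivI:
  assumes "A \<in> carrier_mat m m" "B \<in> carrier_mat m m"
    "bij_betw p {..<m} {..<m}" "s \<in> {..<m} \<rightarrow> {1, -1}"
    "\<And>i j. i < m \<Longrightarrow> j < m \<Longrightarrow> B $$ (i, j) = s i * s j * A $$ (p i, p j)"
  shows "switching_equiv m A B"
  unfolding switching_equiv_def
  by (intro conjI exI[of _ p] exI[of _ s] allI impI assms)

lemma switching_equivE:
  assumes "switching_equiv m A B"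
  obtains p s where "A \<in> carrier_mat m m" "B \<in> carrier_mat m m"
    "bij_betw p {..<m} {..<m}" "s \<in> {..<m} \<rightarrow> {1, -1}"
    "\<forall>i<m. \<forall>j<m. B $$ (i, j) = s i * s j * A $$ (p i, p j)"
  using assms unfolding switching_equiv_def
  by (elim conjE exE) (rule that)

lemma switching_equiv_iff:
  assumes A: "A \<in> carrier_mat m m"
  shows "(\<exists>Q. signed_permutation_matrix m Q \<and> B = transpose_mat Q * A * Q) \<longleftrightarrow> switching_equiv m A B"
    (is "?L \<longleftrightarrow> ?R")
proof
  assume ?L
  then obtain Q where Q: "signed_permutation_matrix m Q" and B: "B = transpose_mat Q * A * Q" by blast
  have car: "transpose_mat Q \<in> carrier_mat m m" "Q \<in> carrier_mat m m"
    using Q by (simp_all add: signed_permutation_matrix_def)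
  obtain q t where q: "bij_betw q {..<m} {..<m}" "t \<in> {..<m} \<rightarrow> {1, -1}"
    "\<And>i j. i < m \<Longrightarrow> j < m \<Longrightarrow> Q $$ (i, j) = (if i = q j then t j else 0)"
    using signed_permutation_matrixE_col[OF Q] by blast
  have qT: "transpose_mat Q $$ (i, j) = (if j = q i then t i else 0)" if "i < m" "j < m" for i j
    using that car q(3) by simp
  have lt: "q i < m" if "i < m" for i using q(1) that by (auto dest: bij_betwE)
  have "\<forall>i<m. \<forall>j<m. B $$ (i, j) = t i * t j * A $$ (q i, q j)"
    unfolding B using index_monomial_mult[OF A car lt lt qT q(3)] by (intro allI impI)
  moreover have "B \<in> carrier_mat m m" using car A B by auto
  ultimately show ?R unfolding switching_equiv_def using A q(1,2)
    by (intro conjI exI[of _ q] exI[of _ t])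
next
  assume ?R
  then obtain q t where "A \<in> carrier_mat m m" and B: "B \<in> carrier_mat m m"
    and q: "bij_betw q {..<m} {..<m}" "t \<in> {..<m} \<rightarrow> {1, -1}"
    and eq: "\<forall>i<m. \<forall>j<m. B $$ (i, j) = t i * t j * A $$ (q i, q j)"
    by (rule switching_equivE)
  define Q where "Q = mat m m (\<lambda>(i, j). if i = q j then t j else 0)"
  have car: "transpose_mat Q \<in> carrier_mat m m" "Q \<in> carrier_mat m m" by (auto simp: Q_def)
  have lt: "q i < m" if "i < m" for i using q(1) that by (auto dest: bij_betwE)
  have "(transpose_mat Q * A * Q) $$ (i, j) = B $$ (i, j)" if "i < m" "j < m" for i j
    using index_monomial_mult[OF A car, of q q t t i j] that lt eq by (simp add: Q_def)
  then have "B = transpose_mat Q * A * Q" using B car by (intro eq_matI) auto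
  then show ?L using signed_permutation_matrix_col[OF q] unfolding Q_def[symmetric]
    by (intro exI[of _ Q] conjI)
qed

lemma pm1_mult_self: "x \<in> {1, -1 :: real} \<Longrightarrow> x * x = 1"
  by auto

lemma inverse_permutationE:
  assumes "bij_betw p {..<n::nat} {..<n}"
  obtains p' where "bij_betw p' {..<n} {..<n}" "\<forall>i<n. p' i < n \<and> p (p' i) = i \<and> p' (p i) = i"
proof
  show bij: "bij_betw (inv_into {..<n} p) {..<n} {..<n}" by (rule bij_betw_inv_into[OF assms])
  show "\<forall>i<n. inv_into {..<n} p i < n \<and> p (inv_into {..<n} p i) = i \<and> inv_into {..<n} p (p i) = i"
    using bij_betw_inv_into_right[OF assms] bij_betw_inv_into_left[OF assms] bij_betwE[OF bij]
    by auto
qed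

lemma switching_equiv_sym:
  assumes "switching_equiv m A B"
  shows "switching_equiv m B A"
proof -
  obtain p s where A: "A \<in> carrier_mat m m" and B: "B \<in> carrier_mat m m"
    and p: "bij_betw p {..<m} {..<m}" and s: "s \<in> {..<m} \<rightarrow> {1, -1}"
    and eq: "\<forall>i<m. \<forall>j<m. B $$ (i, j) = s i * s j * A $$ (p i, p j)"
    using assms by (rule switching_equivE)
  obtain p' where p': "bij_betw p' {..<m} {..<m}" "\<forall>i<m. p' i < m \<and> p (p' i) = i \<and> p' (p i) = i"
    by (rule inverse_permutationE[OF p])
  have s': "s \<circ> p' \<in> {..<m} \<rightarrow> {1, -1}" using s p'(2) by (simp add: Pi_iff)
  have "A $$ (i, j) = (s \<circ> p') i * (s \<circ> p') j * B $$ (p' i, p' j)" if "i < m" "j < m" for i j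
  proof -
    have "s (p' i) * s (p' i) = 1" "s (p' j) * s (p' j) = 1"
      using s' that by (auto simp: Pi_iff intro!: pm1_mult_self)
    then have "(s (p' i) * s (p' i)) * (s (p' j) * s (p' j)) * A $$ (i, j) = A $$ (i, j)" by simp
    then show ?thesis using that p' eq by (simp add: mult_ac)
  qed
  then show ?thesis by (rule switching_equivI[OF B A p'(1) s'])
qed

lemma switching_equiv_trans:
  assumes "switching_equiv m A B" "switching_equiv m B C"
  shows "switching_equiv m A C"
proof -
  obtain p s where A: "A \<in> carrier_mat m m" and B: "B \<in> carrier_mat m m"
    and p: "bij_betw p {..<m} {..<m}" and s: "s \<in> {..<m} \<rightarrow> {1, -1}"
    and eq: "\<forall>i<m. \<forall>j<m. B $$ (i, j) = s i * s j * A $$ (p i, p j)"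
    using assms(1) by (rule switching_equivE)
  obtain q t where B: "B \<in> carrier_mat m m" and C: "C \<in> carrier_mat m m"
    and q: "bij_betw q {..<m} {..<m}" and t: "t \<in> {..<m} \<rightarrow> {1, -1}"
    and eq': "\<forall>i<m. \<forall>j<m. C $$ (i, j) = t i * t j * B $$ (q i, q j)"
    using assms(2) by (rule switching_equivE)
  have lt: "q i < m" if "i < m" for i using q that by (auto dest: bij_betwE)
  have bij: "bij_betw (p \<circ> q) {..<m} {..<m}" using p q by (rule bij_betw_trans[rotated])
  have pm: "(\<lambda>i. t i * s (q i)) \<in> {..<m} \<rightarrow> {1, -1}"
  proof
    fix i assume "i \<in> {..<m}"
    then have "t i \<in> {1, -1}" "s (q i) \<in> {1, -1}" using s t lt by auto
    then show "t i * s (q i) \<in> {1, -1}" by auto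
  qed
  show ?thesis
    by (rule switching_equivI[OF A C bij pm]) (simp_all add: eq eq' lt mult_ac)
qed

section \<open>Equivalence of matrices as an equivalence relation, compatible with
  transposition\<close>

lemma weighing_equivalent_refl: "M \<in> carrier_mat n n \<Longrightarrow> weighing_equivalent n M M"
  by (subst weighing_equivalent_iff) (auto intro!: exI[of _ "id :: nat \<Rightarrow> nat"] exI[of _ "\<lambda>_. 1 :: real"])

lemma weighing_equivalent_sym:
  assumes N: "N \<in> carrier_mat n n" and "weighing_equivalent n M N"
  shows "weighing_equivalent n N M"
proof -
  obtain p q s t where M: "M \<in> carrier_mat n n"
    and p: "bij_betw p {..<n} {..<n}" and q: "bij_betw q {..<n} {..<n}"
    and s: "s \<in> {..<n} \<rightarrow> {1, -1}" and t: "t \<in> {..<n} \<rightarrow> {1, -1}"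
    and eq: "\<forall>i<n. \<forall>j<n. M $$ (i, j) = s i * t j * N $$ (p i, q j)"
    using assms(2) N by (rule weighing_equivalentE)
  obtain p' where p': "bij_betw p' {..<n} {..<n}" "\<forall>i<n. p' i < n \<and> p (p' i) = i \<and> p' (p i) = i"
    by (rule inverse_permutationE[OF p])
  obtain q' where q': "bij_betw q' {..<n} {..<n}" "\<forall>i<n. q' i < n \<and> q (q' i) = i \<and> q' (q i) = i"
    by (rule inverse_permutationE[OF q])
  have s': "s \<circ> p' \<in> {..<n} \<rightarrow> {1, -1}" "t \<circ> q' \<in> {..<n} \<rightarrow> {1, -1}"
    using s t p'(2) q'(2) by (simp_all add: Pi_iff)
  have "N $$ (i, j) = (s \<circ> p') i * (t \<circ> q') j * M $$ (p' i, q' j)" if "i < n" "j < n" for i j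
  proof -
    have "s (p' i) * s (p' i) = 1" "t (q' j) * t (q' j) = 1"
      using s' that by (auto simp: Pi_iff intro!: pm1_mult_self)
    then have "(s (p' i) * s (p' i)) * (t (q' j) * t (q' j)) * N $$ (i, j) = N $$ (i, j)" by simp
    then show ?thesis using that p' q' eq by (simp add: mult_ac)
  qed
  then show ?thesis by (rule weighing_equivalentI[OF N M p'(1) q'(1) s'])
qed

lemma weighing_equivalent_trans:
  assumes N: "N \<in> carrier_mat n n" and "weighing_equivalent n L M" "weighing_equivalent n M N"
  shows "weighing_equivalent n L N"
proof -
  obtain p q s t where M: "M \<in> carrier_mat n n"
    and p: "bij_betw p {..<n} {..<n}" and q: "bij_betw q {..<n} {..<n}"
    and s: "s \<in> {..<n} \<rightarrow> {1, -1}" and t: "t \<in> {..<n} \<rightarrow> {1, -1}"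
    and eq: "\<forall>i<n. \<forall>j<n. M $$ (i, j) = s i * t j * N $$ (p i, q j)"
    using assms(3) N by (rule weighing_equivalentE)
  obtain p' q' s' t' where L: "L \<in> carrier_mat n n"
    and p': "bij_betw p' {..<n} {..<n}" and q': "bij_betw q' {..<n} {..<n}"
    and s': "s' \<in> {..<n} \<rightarrow> {1, -1}" and t': "t' \<in> {..<n} \<rightarrow> {1, -1}"
    and eq': "\<forall>i<n. \<forall>j<n. L $$ (i, j) = s' i * t' j * M $$ (p' i, q' j)"
    using assms(2) M by (rule weighing_equivalentE)
  have lt: "p' i < n" "q' i < n" if "i < n" for i using p' q' that by (auto dest: bij_betwE)
  have pm: "(\<lambda>i. x i * y (z i)) \<in> {..<n} \<rightarrow> {1, -1}"
    if "x \<in> {..<n} \<rightarrow> {1, -1}" "y \<in> {..<n} \<rightarrow> {1, -1}" "\<And>i. i < n \<Longrightarrow> z i < n"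
    for x y :: "nat \<Rightarrow> real" and z
  proof
    fix i assume "i \<in> {..<n}"
    then have "x i \<in> {1, -1}" "y (z i) \<in> {1, -1}" using that by auto
    then show "x i * y (z i) \<in> {1, -1}" by auto
  qed
  have bij: "bij_betw (p \<circ> p') {..<n} {..<n}" "bij_betw (q \<circ> q') {..<n} {..<n}"
    using p p' q q' by (auto intro: bij_betw_trans)
  show ?thesis
  proof (rule weighing_equivalentI[OF L N bij pm[OF s' s lt(1)] pm[OF t' t lt(2)]])
    fix i j assume ij: "i < n" "j < n"
    have "L $$ (i, j) = s' i * t' j * M $$ (p' i, q' j)" using eq' ij by simp
    also have "M $$ (p' i, q' j) = s (p' i) * t (q' j) * N $$ ((p \<circ> p') i, (q \<circ> q') j)"
      using eq lt ij by simp
    finally show "L $$ (i, j) = s' i * s (p' i) * (t' j * t (q' j)) * N $$ ((p \<circ> p') i, (q \<circ> q') j)"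
      by (simp only: mult_ac)
  qed
qed

lemma weighing_equivalent_transpose:
  assumes N: "N \<in> carrier_mat n n" and "weighing_equivalent n M N"
  shows "weighing_equivalent n (transpose_mat M) (transpose_mat N)"
proof -
  obtain p q s t where M: "M \<in> carrier_mat n n"
    and p: "bij_betw p {..<n} {..<n}" and q: "bij_betw q {..<n} {..<n}"
    and s: "s \<in> {..<n} \<rightarrow> {1, -1}" and t: "t \<in> {..<n} \<rightarrow> {1, -1}"
    and eq: "\<forall>i<n. \<forall>j<n. M $$ (i, j) = s i * t j * N $$ (p i, q j)"
    using assms(2) N by (rule weighing_equivalentE)
  have lt: "p i < n" "q i < n" if "i < n" for i using p q that by (auto dest: bij_betwE)
  have "transpose_mat M \<in> carrier_mat n n" "transpose_mat N \<in> carrier_mat n n"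
    using M N by auto
  then show ?thesis
    by (rule weighing_equivalentI[OF _ _ q p t s]) (use M N lt eq in \<open>simp_all add: mult_ac\<close>)
qed

section \<open>Weighing matrices up to equivalence\<close>

lemma weighing_matrix_iff:
  "weighing_matrix n r M \<longleftrightarrow> M \<in> carrier_mat n n \<and>
     (\<forall>i<n. \<forall>j<n. M $$ (i, j) \<in> {0, 1, -1}) \<and>
     (\<forall>j<n. \<forall>k<n. (\<Sum>i<n. M $$ (i, j) * M $$ (i, k)) = (if j = k then real r else 0))"
proof (cases "M \<in> carrier_mat n n")
  case M: True
  have idx: "(transpose_mat M * M) $$ (j, k) = (\<Sum>i<n. M $$ (i, j) * M $$ (i, k))"
    if "j < n" "k < n" for j k
    using M that by (subst index_mult_mat_sum[of _ n n _ n]) (auto intro!: sum.cong)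
  have "transpose_mat M * M = real r \<cdot>\<^sub>m 1\<^sub>m n \<longleftrightarrow>
      (\<forall>j<n. \<forall>k<n. (\<Sum>i<n. M $$ (i, j) * M $$ (i, k)) = (if j = k then real r else 0))"
    (is "?L \<longleftrightarrow> ?R")
  proof
    assume ?L
    show ?R
    proof (intro allI impI)
      fix j k assume "j < n" "k < n"
      then show "(\<Sum>i<n. M $$ (i, j) * M $$ (i, k)) = (if j = k then real r else 0)"
        using idx[of j k] \<open>?L\<close> by (cases "j = k") simp_all
    qed
  next
    assume ?R
    then show ?L using M idx by (intro eq_matI) auto
  qed
  then show ?thesis by (simp add: weighing_matrix_def)
qed (simp add: weighing_matrix_def)

lemma weighing_matrix_carrier: "weighing_matrix n r M \<Longrightarrow> M \<in> carrier_mat n n"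
  by (simp add: weighing_matrix_def)

text \<open>Since \<open>r\<close> is positive, the identity for the columns says that
  \<open>transpose_mat M\<close> divided by \<open>r\<close> is a left inverse of \<open>M\<close>.
  A left inverse of a square matrix is two-sided, which is the identity for the rows.\<close>

lemma weighing_matrix_transpose:
  assumes "weighing_matrix n r M" "0 < r"
  shows "weighing_matrix n r (transpose_mat M)"
proof -
  have M: "M \<in> carrier_mat n n" and eq: "transpose_mat M * M = real r \<cdot>\<^sub>m 1\<^sub>m n"
    and ent: "\<forall>i<n. \<forall>j<n. M $$ (i, j) \<in> {0, 1, -1}"
    using assms by (simp_all add: weighing_matrix_def)
  define L where "L = (1 / real r) \<cdot>\<^sub>m transpose_mat M"
  have L: "L \<in> carrier_mat n n" using M by (simp add: L_def)
  have "L * M = (1 / real r) \<cdot>\<^sub>m (transpose_mat M * M)"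
    unfolding L_def using M by (intro mult_smult_assoc_mat) auto
  also have "\<dots> = 1\<^sub>m n"
    unfolding eq using assms(2) by (intro eq_matI) auto
  finally have "M * L = 1\<^sub>m n" by (rule mat_mult_left_right_inverse[OF L M])
  moreover have "M * L = (1 / real r) \<cdot>\<^sub>m (M * transpose_mat M)"
    unfolding L_def using M by (intro mult_smult_distrib) auto
  ultimately have "real r \<cdot>\<^sub>m 1\<^sub>m n = real r \<cdot>\<^sub>m ((1 / real r) \<cdot>\<^sub>m (M * transpose_mat M))" by simp
  also have "\<dots> = M * transpose_mat M" using assms(2) M by (intro eq_matI) auto
  finally show ?thesis using M ent unfolding weighing_matrix_def by simp
qed

lemma rows_intersect_0_or_2_iff:
  assumes "M \<in> carrier_mat n n"
  shows "rows_intersect_0_or_2 M \<longleftrightarrow> (\<forall>i<n. \<forall>k<n. i \<noteq> k \<longrightarrow>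
     card {j. j < n \<and> M $$ (i, j) \<noteq> 0 \<and> M $$ (k, j) \<noteq> 0} \<in> {0, 2})"
proof -
  have "row_support M i \<inter> row_support M k = {j. j < n \<and> M $$ (i, j) \<noteq> 0 \<and> M $$ (k, j) \<noteq> 0}" for i k
    using assms by (auto simp: row_support_def)
  then show ?thesis using assms by (simp add: rows_intersect_0_or_2_def)
qed

text \<open>Three rows meeting in the same two columns would be pairwise orthogonal there, but three
  signs cannot be pairwise opposite.\<close>

lemma rows_intersect_0_or_2_transpose:
  assumes w: "weighing_matrix n r M" and "0 < r" and r02: "rows_intersect_0_or_2 M"
  shows "rows_intersect_0_or_2 (transpose_mat M)"
proof -
  have M: "M \<in> carrier_mat n n" using w by (rule weighing_matrix_carrier)
  have ent: "M $$ (i, j) \<in> {0, 1, -1}" if "i < n" "j < n" for i j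
    using w that by (simp add: weighing_matrix_def)
  have orth_col: "(\<Sum>i<n. M $$ (i, j) * M $$ (i, k)) = 0" if "j < n" "k < n" "j \<noteq> k" for j k
    using w that by (simp add: weighing_matrix_iff)
  have "(\<Sum>l<n. transpose_mat M $$ (l, i) * transpose_mat M $$ (l, k)) = 0"
    if "i < n" "k < n" "i \<noteq> k" for i k
    using weighing_matrix_transpose[OF w \<open>0 < r\<close>] that by (simp only: weighing_matrix_iff) simp
  then have orth_row: "(\<Sum>l<n. M $$ (i, l) * M $$ (k, l)) = 0" if "i < n" "k < n" "i \<noteq> k" for i k
    using that M by simp
  have "card {i. i < n \<and> M $$ (i, j) \<noteq> 0 \<and> M $$ (i, k) \<noteq> 0} \<in> {0, 2}" (is "card ?T \<in> _")
    if jk: "j < n" "k < n" "j \<noteq> k" for j k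
  proof -
    have opp: "M $$ (i, j) * M $$ (i, k) = - (M $$ (l, j) * M $$ (l, k))"
      if il: "i \<in> ?T" "l \<in> ?T" "i \<noteq> l" for i l
    proof -
      let ?S = "{c. c < n \<and> M $$ (i, c) \<noteq> 0 \<and> M $$ (l, c) \<noteq> 0}"
      have "card ?S \<in> {0, 2}" using r02 il by (simp add: rows_intersect_0_or_2_iff[OF M])
      moreover have sub: "{j, k} \<subseteq> ?S" using il jk by auto
      then have "card ?S \<noteq> 0" using jk(1) by auto
      \<comment> \<open>Two rows that both meet columns \<open>j\<close> and \<open>k\<close> meet
        nowhere else, so their inner product has exactly two terms, and orthogonality makes these
        opposite.\<close>
      ultimately have "?S = {j, k}" using card_subset_eq[OF _ sub] jk(3) by simp
      have "0 = (\<Sum>c<n. M $$ (i, c) * M $$ (l, c))" using orth_row il by simp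
      also have "\<dots> = (\<Sum>c\<in>?S. M $$ (i, c) * M $$ (l, c))"
        by (rule sum.mono_neutral_right) auto
      also have "\<dots> = M $$ (i, j) * M $$ (l, j) + M $$ (i, k) * M $$ (l, k)"
        unfolding \<open>?S = _\<close> using jk(3) by simp
      finally have "M $$ (i, j) * M $$ (l, j) + M $$ (i, k) * M $$ (l, k) = 0" by simp
      moreover have "M $$ (i, j) \<in> {1, -1}" "M $$ (i, k) \<in> {1, -1}"
        "M $$ (l, j) \<in> {1, -1}" "M $$ (l, k) \<in> {1, -1}"
        using ent[of i j] ent[of i k] ent[of l j] ent[of l k] il jk by auto
      ultimately show ?thesis by auto
    qed
    have "card ?T \<le> 2"
    proof (rule ccontr)
      assume "\<not> card ?T \<le> 2"
      then obtain U where "U \<subseteq> ?T" "card U = 3"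
        using obtain_subset_with_card_n[of 3 ?T] by auto
      then obtain a b c where abc: "a \<in> ?T" "b \<in> ?T" "c \<in> ?T" "a \<noteq> b" "b \<noteq> c" "a \<noteq> c"
        by (auto simp: card_3_iff)
      then have "M $$ (a, j) * M $$ (a, k) = 0"
        using opp[of a b] opp[of b c] opp[of a c] by linarith
      then show False using abc(1) by simp
    qed
    \<comment> \<open>A single common row would leave one nonzero term in the inner product of two
      orthogonal columns.\<close>
    moreover have "card ?T \<noteq> 1"
    proof
      assume "card ?T = 1"
      then obtain i where i: "?T = {i}" by (auto simp: card_1_singleton_iff)
      have "0 = (\<Sum>l<n. M $$ (l, j) * M $$ (l, k))" using orth_col jk by simp
      also have "\<dots> = (\<Sum>l\<in>?T. M $$ (l, j) * M $$ (l, k))"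
        by (rule sum.mono_neutral_right) auto
      also have "\<dots> = M $$ (i, j) * M $$ (i, k)" unfolding i by simp
      finally show False using i by auto
    qed
    ultimately have "card ?T = 0 \<or> card ?T = 2" by linarith
    then show ?thesis by blast
  qed
  moreover have "{i. i < n \<and> transpose_mat M $$ (j, i) \<noteq> 0 \<and> transpose_mat M $$ (k, i) \<noteq> 0} =
      {i. i < n \<and> M $$ (i, j) \<noteq> 0 \<and> M $$ (i, k) \<noteq> 0}" if "j < n" "k < n" for j k
    using that M by auto
  ultimately show ?thesis
    using M by (subst rows_intersect_0_or_2_iff[of _ n]) auto
qed

text \<open>In the inner product of two columns each row sign occurs squared and the row permutation
  only reindexes the sum. The column signs come out as a factor, which is 1 on the diagonal and
  multiplies 0 elsewhere.\<close>

lemma weighing_matrix_equivalent: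
  assumes w: "weighing_matrix n r N" and "weighing_equivalent n M N"
  shows "weighing_matrix n r M"
proof -
  have N: "N \<in> carrier_mat n n" using w by (rule weighing_matrix_carrier)
  obtain p q s t where M: "M \<in> carrier_mat n n"
    and p: "bij_betw p {..<n} {..<n}" and q: "bij_betw q {..<n} {..<n}"
    and s: "s \<in> {..<n} \<rightarrow> {1, -1}" and t: "t \<in> {..<n} \<rightarrow> {1, -1}"
    and eq: "\<forall>i<n. \<forall>j<n. M $$ (i, j) = s i * t j * N $$ (p i, q j)"
    using assms(2) N by (rule weighing_equivalentE)
  have lt: "p i < n" "q i < n" if "i < n" for i using p q that by (auto dest: bij_betwE)
  have "M $$ (i, j) \<in> {0, 1, -1}" if ij: "i < n" "j < n" for i j
  proof -
    have "s i \<in> {1, -1}" "t j \<in> {1, -1}" "N $$ (p i, q j) \<in> {0, 1, -1}"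
      using s t w ij lt by (auto simp: weighing_matrix_def)
    then show ?thesis using eq ij by auto
  qed
  moreover have "(\<Sum>i<n. M $$ (i, j) * M $$ (i, k)) = (if j = k then real r else 0)"
    if jk: "j < n" "k < n" for j k
  proof -
    have "(\<Sum>i<n. M $$ (i, j) * M $$ (i, k)) =
        (\<Sum>i<n. t j * t k * (N $$ (p i, q j) * N $$ (p i, q k)))"
    proof (rule sum.cong)
      fix i assume i: "i \<in> {..<n}"
      then have "s i * s i = 1" using s by (intro pm1_mult_self) auto
      then show "M $$ (i, j) * M $$ (i, k) = t j * t k * (N $$ (p i, q j) * N $$ (p i, q k))"
        using eq i jk by (simp add: mult_ac)
    qed simp
    also have "\<dots> = t j * t k * (\<Sum>i<n. N $$ (i, q j) * N $$ (i, q k))"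
      by (simp only: sum_distrib_left[symmetric]
          sum.reindex_bij_betw[OF p, of "\<lambda>i. N $$ (i, q j) * N $$ (i, q k)"])
    also have "\<dots> = t j * t k * (if q j = q k then real r else 0)"
      using w lt jk by (simp add: weighing_matrix_iff)
    also have "\<dots> = (if j = k then real r else 0)"
    proof -
      have "q j = q k \<longleftrightarrow> j = k" using q jk by (auto simp: bij_betw_def inj_on_def)
      moreover have "t j * t j = 1" using t jk by (intro pm1_mult_self) auto
      ultimately show ?thesis by auto
    qed
    finally show ?thesis .
  qed
  ultimately show ?thesis using M by (simp add: weighing_matrix_iff)
qed

lemma rows_intersect_0_or_2_equivalent:
  assumes N: "N \<in> carrier_mat n n" and r02: "rows_intersect_0_or_2 N"
    and "weighing_equivalent n M N"
  shows "rows_intersect_0_or_2 M"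
proof -
  obtain p q s t where M: "M \<in> carrier_mat n n"
    and p: "bij_betw p {..<n} {..<n}" and q: "bij_betw q {..<n} {..<n}"
    and s: "s \<in> {..<n} \<rightarrow> {1, -1}" and t: "t \<in> {..<n} \<rightarrow> {1, -1}"
    and eq: "\<forall>i<n. \<forall>j<n. M $$ (i, j) = s i * t j * N $$ (p i, q j)"
    using assms(3) N by (rule weighing_equivalentE)
  have lt: "p i < n" "q i < n" if "i < n" for i using p q that by (auto dest: bij_betwE)
  have nz: "M $$ (i, j) \<noteq> 0 \<longleftrightarrow> N $$ (p i, q j) \<noteq> 0" if ij: "i < n" "j < n" for i j
  proof -
    have "s i \<in> {1, -1}" "t j \<in> {1, -1}" using s t ij by auto
    then show ?thesis using eq ij by auto
  qed
  have "card {j. j < n \<and> M $$ (i, j) \<noteq> 0 \<and> M $$ (k, j) \<noteq> 0} \<in> {0, 2}"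
    if ik: "i < n" "k < n" "i \<noteq> k" for i k
  proof -
    have "q ` {j. j < n \<and> M $$ (i, j) \<noteq> 0 \<and> M $$ (k, j) \<noteq> 0} =
        {j. j < n \<and> N $$ (p i, j) \<noteq> 0 \<and> N $$ (p k, j) \<noteq> 0}" (is "q ` ?A = ?B")
    proof
      show "q ` ?A \<subseteq> ?B"
      proof (rule image_subsetI)
        fix j assume "j \<in> ?A"
        then show "q j \<in> ?B" using nz[of i j] nz[of k j] lt(2)[of j] ik by simp
      qed
      show "?B \<subseteq> q ` ?A"
      proof
        fix c assume c: "c \<in> ?B"
        then have "c \<in> q ` {..<n}" using bij_betw_imp_surj_on[OF q] by simp
        then obtain j where j: "c = q j" "j \<in> {..<n}" by (rule imageE)
        then have "j \<in> ?A" using c nz[of i j] nz[of k j] ik by simp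
        then show "c \<in> q ` ?A" unfolding j(1) by (rule imageI)
      qed
    qed
    moreover have "inj_on q ?A" using bij_betw_imp_inj_on[OF q] by (rule inj_on_subset) auto
    then have "card (q ` ?A) = card ?A" by (rule card_image)
    ultimately have "card ?A = card ?B" by simp
    moreover have "p i \<noteq> p k" using inj_onD[OF bij_betw_imp_inj_on[OF p], of i k] ik by auto
    ultimately show ?thesis
      using r02 lt ik by (simp add: rows_intersect_0_or_2_iff[OF N])
  qed
  then show ?thesis by (simp add: rows_intersect_0_or_2_iff[OF M])
qed

text \<open>\<open>R\<close> is a set of rows and \<open>C\<close> a set of columns such that no
  nonzero entry lies in exactly one of them: a block decomposition up to reordering, or a union of
  components of the row-column graph. Equal size of \<open>R\<close> and \<open>C\<close> is not
  demanded but proved.\<close>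

definition splits :: "nat \<Rightarrow> real mat \<Rightarrow> nat set \<Rightarrow> nat set \<Rightarrow> bool" where
  "splits n M R C \<longleftrightarrow> R \<subseteq> {..<n} \<and> C \<subseteq> {..<n} \<and>
     (\<forall>i<n. \<forall>j<n. M $$ (i, j) \<noteq> 0 \<longrightarrow> (i \<in> R \<longleftrightarrow> j \<in> C))"

lemma splits_transpose:
  assumes "M \<in> carrier_mat n n"
  shows "splits n (transpose_mat M) R C \<longleftrightarrow> splits n M C R"
  using assms by (auto simp: splits_def)

lemma splits_card_eq:
  assumes w: "weighing_matrix n r M" and r: "0 < r" and sp: "splits n M R C"
  shows "card R = card C"
proof -
  have M: "M \<in> carrier_mat n n" using w by (rule weighing_matrix_carrier)
  have R: "R \<subseteq> {..<n}" and C: "C \<subseteq> {..<n}" using sp by (simp_all add: splits_def)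
  have col: "(\<Sum>i<n. M $$ (i, j) * M $$ (i, j)) = real r" if "j < n" for j
    using w that by (simp add: weighing_matrix_iff)
  have "(\<Sum>j<n. transpose_mat M $$ (j, i) * transpose_mat M $$ (j, i)) = real r" if "i < n" for i
    using weighing_matrix_transpose[OF w r] that by (simp only: weighing_matrix_iff) simp
  then have row: "(\<Sum>j<n. M $$ (i, j) * M $$ (i, j)) = real r" if "i < n" for i
    using that M by simp
  \<comment> \<open>The squared entries in the block \<open>R\<close> by \<open>C\<close> are summed
    in two ways: rows in \<open>R\<close> vanish outside \<open>C\<close>, columns in
    \<open>C\<close> vanish outside \<open>R\<close>, and every full row or column sums to
    \<open>r\<close>.\<close>
  have "real r * real (card R) = (\<Sum>i\<in>R. \<Sum>j<n. M $$ (i, j) * M $$ (i, j))"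
    using row R by (simp add: subset_iff)
  also have "\<dots> = (\<Sum>i\<in>R. \<Sum>j\<in>C. M $$ (i, j) * M $$ (i, j))"
  proof (rule sum.cong)
    fix i assume "i \<in> R"
    then show "(\<Sum>j<n. M $$ (i, j) * M $$ (i, j)) = (\<Sum>j\<in>C. M $$ (i, j) * M $$ (i, j))"
      using sp C by (intro sum.mono_neutral_right) (auto simp: splits_def)
  qed simp
  also have "\<dots> = (\<Sum>j\<in>C. \<Sum>i\<in>R. M $$ (i, j) * M $$ (i, j))" by (rule sum.swap)
  also have "\<dots> = (\<Sum>j\<in>C. \<Sum>i<n. M $$ (i, j) * M $$ (i, j))"
  proof (rule sum.cong)
    fix j assume "j \<in> C"
    then show "(\<Sum>i\<in>R. M $$ (i, j) * M $$ (i, j)) = (\<Sum>i<n. M $$ (i, j) * M $$ (i, j))"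
      using sp R by (intro sum.mono_neutral_left) (auto simp: splits_def)
  qed simp
  also have "\<dots> = real r * real (card C)" using col C by (simp add: subset_iff)
  finally show ?thesis using r by simp
qed

section \<open>Direct sums, and properness as the absence of nontrivial splits\<close>

lemma sum_lessThan_add:
  "(\<Sum>i<k + l. f i) = (\<Sum>i<k. f i) + (\<Sum>i<l. f (k + i :: nat))"
  for f :: "nat \<Rightarrow> 'a::comm_monoid_add"
  by (induction l) (simp_all add: add.assoc)

lemma index_direct_sum_mat:
  assumes "A \<in> carrier_mat k k" "B \<in> carrier_mat l l" "i < k + l" "j < k + l"
  shows "direct_sum_mat A B $$ (i, j) =
    (if i < k then if j < k then A $$ (i, j) else 0
     else if j < k then 0 else B $$ (i - k, j - k))"
  using assms by (auto simp: direct_sum_mat_def)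

lemma direct_sum_mat_carrier:
  "A \<in> carrier_mat k k \<Longrightarrow> B \<in> carrier_mat l l \<Longrightarrow> direct_sum_mat A B \<in> carrier_mat (k + l) (k + l)"
  by (auto simp: direct_sum_mat_def)

text \<open>The zero blocks contribute nothing to inner products of columns from the same block.
  Both summands inherit the same \<open>r\<close>, although the definition of properness allows two
  different weights.\<close>

lemma weighing_matrix_direct_sumD:
  assumes A: "A \<in> carrier_mat k k" and B: "B \<in> carrier_mat l l"
    and w: "weighing_matrix (k + l) r (direct_sum_mat A B)"
  shows "weighing_matrix k r A" "weighing_matrix l r B"
proof -
  let ?D = "direct_sum_mat A B"
  note D = index_direct_sum_mat[OF A B]
  have ent: "?D $$ (i, j) \<in> {0, 1, -1}" if "i < k + l" "j < k + l" for i j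
    using w that by (simp add: weighing_matrix_def)
  have orth: "(\<Sum>i<k. ?D $$ (i, j) * ?D $$ (i, j')) + (\<Sum>i<l. ?D $$ (k + i, j) * ?D $$ (k + i, j'))
      = (if j = j' then real r else 0)" if "j < k + l" "j' < k + l" for j j'
    using w that unfolding weighing_matrix_iff sum_lessThan_add by simp
  show "weighing_matrix k r A"
    unfolding weighing_matrix_iff
  proof (intro conjI allI impI A)
    fix i j assume "i < k" "j < k"
    then show "A $$ (i, j) \<in> {0, 1, -1}" using ent[of i j] by (simp add: D)
  next
    fix j j' assume "j < k" "j' < k"
    then show "(\<Sum>i<k. A $$ (i, j) * A $$ (i, j')) = (if j = j' then real r else 0)"
      using orth[of j j'] by (simp add: D)
  qed
  show "weighing_matrix l r B"
    unfolding weighing_matrix_iff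
  proof (intro conjI allI impI B)
    fix i j assume "i < l" "j < l"
    then show "B $$ (i, j) \<in> {0, 1, -1}" using ent[of "k + i" "k + j"] by (simp add: D)
  next
    fix j j' assume "j < l" "j' < l"
    then show "(\<Sum>i<l. B $$ (i, j) * B $$ (i, j')) = (if j = j' then real r else 0)"
      using orth[of "k + j" "k + j'"] by (simp add: D)
  qed
qed

text \<open>Moves a chosen set of rows or columns to the front, which turns a split into an actual
  block form. The permutation is glued from a bijection on \<open>R\<close> and one on its
  complement.\<close>

lemma permutation_to_initial_segment:
  assumes R: "R \<subseteq> {..<n::nat}" and k: "card R = k"
  obtains p where "bij_betw p {..<n} {..<n}" "\<forall>i<n. p i < k \<longleftrightarrow> i \<in> R"
proof -
  have fin: "finite R" using R finite_subset by blast
  have kn: "k \<le> n" using card_mono[OF _ R] k by simp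
  obtain f where f: "bij_betw f R {..<k}"
    using ex_bij_betw_finite_nat[OF fin] k by (auto simp: atLeast0LessThan)
  have "card ({..<n} - R) = card {k..<n}" using card_Diff_subset[OF fin R] k by simp
  then obtain g where g: "bij_betw g ({..<n} - R) {k..<n}"
    using finite_same_card_bij[of "{..<n} - R" "{k..<n}"] by auto
  define p where "p = (\<lambda>i. if i \<in> R then f i else g i)"
  have "bij_betw p R {..<k}" using f by (rule bij_betw_cong[THEN iffD1, rotated]) (simp add: p_def)
  moreover have "bij_betw p ({..<n} - R) {k..<n}"
    using g by (rule bij_betw_cong[THEN iffD1, rotated]) (simp add: p_def)
  ultimately have "bij_betw p (R \<union> ({..<n} - R)) ({..<k} \<union> {k..<n})"
    by (rule bij_betw_combine) auto
  moreover have "R \<union> ({..<n} - R) = {..<n}" "{..<k} \<union> {k..<n} = {..<n}" using R kn by auto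
  ultimately have "bij_betw p {..<n} {..<n}" by simp
  moreover have "p i < k \<longleftrightarrow> i \<in> R" if "i < n" for i
    using bij_betwE[OF f, rule_format, of i] bij_betwE[OF g, rule_format, of i] that
    by (cases "i \<in> R") (simp_all add: p_def)
  ultimately show thesis using that by simp
qed

text \<open>A split with \<open>0 < k < n\<close> becomes a direct sum once \<open>R\<close> and
  \<open>C\<close> are moved to the front; the blocks are square because \<open>R\<close> and
  \<open>C\<close> have equal size. Conversely, the first block of a direct sum pulls back along the
  equivalence to a nontrivial split.\<close>

lemma proper_weighing_matrix_iff:
  assumes w: "weighing_matrix n r M" and r: "0 < r"
  shows "proper_weighing_matrix n r M \<longleftrightarrow>
    (\<forall>R C. splits n M R C \<longrightarrow> R = {} \<and> C = {} \<or> R = {..<n} \<and> C = {..<n})"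
proof
  have M: "M \<in> carrier_mat n n" using w by (rule weighing_matrix_carrier)
  assume proper: "proper_weighing_matrix n r M"
  show "\<forall>R C. splits n M R C \<longrightarrow> R = {} \<and> C = {} \<or> R = {..<n} \<and> C = {..<n}"
  proof (intro allI impI)
    fix R C assume sp: "splits n M R C"
    then have R: "R \<subseteq> {..<n}" and C: "C \<subseteq> {..<n}" by (simp_all add: splits_def)
    define k where "k = card R"
    have kC: "card C = k" using splits_card_eq[OF w r sp] by (simp add: k_def)
    have fin: "finite R" "finite C" using R C finite_subset by blast+
    have kn: "k \<le> n" using card_mono[OF _ R] by (simp add: k_def)
    have "k = 0 \<or> k = n"
    proof (rule ccontr)
      assume "\<not> (k = 0 \<or> k = n)"
      then have k: "0 < k" "0 < n - k" "n = k + (n - k)" using kn by auto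
      obtain p where p: "bij_betw p {..<n} {..<n}" "\<forall>i<n. p i < k \<longleftrightarrow> i \<in> R"
        by (rule permutation_to_initial_segment[OF R k_def[symmetric]])
      obtain q where q: "bij_betw q {..<n} {..<n}" "\<forall>i<n. q i < k \<longleftrightarrow> i \<in> C"
        by (rule permutation_to_initial_segment[OF C kC])
      obtain p' where p': "bij_betw p' {..<n} {..<n}" "\<forall>i<n. p' i < n \<and> p (p' i) = i \<and> p' (p i) = i"
        by (rule inverse_permutationE[OF p(1)])
      obtain q' where q': "bij_betw q' {..<n} {..<n}" "\<forall>i<n. q' i < n \<and> q (q' i) = i \<and> q' (q i) = i"
        by (rule inverse_permutationE[OF q(1)])
      \<comment> \<open>\<open>weighing_equivalentI\<close> expresses \<open>M\<close> at
        \<open>(i, j)\<close> through \<open>N\<close> at \<open>(p i, q j)\<close>, so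
        \<open>N\<close> itself is defined with the inverses: its row \<open>i\<close> is the row of
        \<open>M\<close> that \<open>p\<close> sends to \<open>i\<close>.\<close>
      define N where "N = mat n n (\<lambda>(i, j). M $$ (p' i, q' j))"
      define A where "A = mat k k (\<lambda>(i, j). M $$ (p' i, q' j))"
      define B where "B = mat (n - k) (n - k) (\<lambda>(i, j). M $$ (p' (k + i), q' (k + j)))"
      have car: "A \<in> carrier_mat k k" "B \<in> carrier_mat (n - k) (n - k)" "N \<in> carrier_mat n n"
        by (simp_all add: A_def B_def N_def)
      have one: "(\<lambda>_. 1 :: real) \<in> {..<n} \<rightarrow> {1, -1}" by simp
      have lt: "p i < n" "q i < n" if "i < n" for i
        using p q that by (auto dest: bij_betwE)
      have MN: "weighing_equivalent n M N"
        by (rule weighing_equivalentI[OF M car(3) p(1) q(1) one one]) (use lt p' q' in \<open>simp add: N_def\<close>)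
      have N_sum: "N = direct_sum_mat A B"
      proof (rule eq_matI)
        fix i j assume "i < dim_row (direct_sum_mat A B)" "j < dim_col (direct_sum_mat A B)"
        then have ij: "i < n" "j < n" using direct_sum_mat_carrier[OF car(1,2)] k(3) by auto
        have "p' i \<in> R \<longleftrightarrow> i < k" "q' j \<in> C \<longleftrightarrow> j < k" using ij p(2) q(2) p' q' by metis+
        moreover have "p' i < n" "q' j < n" using ij p' q' by simp_all
        ultimately have "M $$ (p' i, q' j) = 0" if "\<not> (i < k \<longleftrightarrow> j < k)"
          using sp that unfolding splits_def by metis
        then have "N $$ (i, j) = 0" if "\<not> (i < k \<longleftrightarrow> j < k)"
          using that ij by (simp add: N_def)
        moreover have "direct_sum_mat A B $$ (i, j) =
            (if i < k then if j < k then A $$ (i, j) else 0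
             else if j < k then 0 else B $$ (i - k, j - k))"
          using car ij k(3) by (intro index_direct_sum_mat[of _ _ _ "n - k"]) auto
        ultimately show "N $$ (i, j) = direct_sum_mat A B $$ (i, j)"
          using ij by (auto simp: A_def B_def N_def)
      qed (use direct_sum_mat_carrier[OF car(1,2)] k(3) in \<open>auto simp: N_def\<close>)
      have "weighing_matrix n r N"
        using w weighing_equivalent_sym[OF car(3) MN] by (rule weighing_matrix_equivalent)
      then have "weighing_matrix k r A" "weighing_matrix (n - k) r B"
        using weighing_matrix_direct_sumD[OF car(1,2), of r] k(3) N_sum by simp_all
      moreover have "weighing_equivalent n M (direct_sum_mat A B)" using MN N_sum by simp
      ultimately show False
        using proper k unfolding proper_weighing_matrix_def by metis
    qed
    then show "R = {} \<and> C = {} \<or> R = {..<n} \<and> C = {..<n}"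
      using fin kC card_subset_eq[OF _ R] card_subset_eq[OF _ C] by (auto simp: k_def)
  qed
next
  have M: "M \<in> carrier_mat n n" using w by (rule weighing_matrix_carrier)
  assume nsp: "\<forall>R C. splits n M R C \<longrightarrow> R = {} \<and> C = {} \<or> R = {..<n} \<and> C = {..<n}"
  have False if n12: "0 < n1" "0 < n2" "n = n1 + n2" and "weighing_matrix n1 r1 A"
    "weighing_matrix n2 r2 B" and eqv: "weighing_equivalent n M (direct_sum_mat A B)" for n1 n2 r1 r2 A B
  proof -
    have A: "A \<in> carrier_mat n1 n1" and B: "B \<in> carrier_mat n2 n2"
      using that(4,5) by (simp_all add: weighing_matrix_carrier)
    have D: "direct_sum_mat A B \<in> carrier_mat n n" using direct_sum_mat_carrier[OF A B] n12 by simp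
    obtain p q s t where "M \<in> carrier_mat n n"
      and p: "bij_betw p {..<n} {..<n}" and q: "bij_betw q {..<n} {..<n}"
      and s: "s \<in> {..<n} \<rightarrow> {1, -1}" and t: "t \<in> {..<n} \<rightarrow> {1, -1}"
      and eq: "\<forall>i<n. \<forall>j<n. M $$ (i, j) = s i * t j * direct_sum_mat A B $$ (p i, q j)"
      using eqv D by (rule weighing_equivalentE)
    have lt: "p i < n" "q i < n" if "i < n" for i using p q that by (auto dest: bij_betwE)
    \<comment> \<open>The rows and columns that the equivalence sends into the first block.\<close>
    have "splits n M {i. i < n \<and> p i < n1} {j. j < n \<and> q j < n1}"
      unfolding splits_def
    proof (intro conjI allI impI)
      fix i j assume ij: "i < n" "j < n" and "M $$ (i, j) \<noteq> 0"
      then have "direct_sum_mat A B $$ (p i, q j) \<noteq> 0" using eq by auto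
      then have "p i < n1 \<longleftrightarrow> q j < n1"
        using index_direct_sum_mat[OF A B, of "p i" "q j"] lt ij n12 by (auto split: if_splits)
      then show "i \<in> {i. i < n \<and> p i < n1} \<longleftrightarrow> j \<in> {j. j < n \<and> q j < n1}" using ij by simp
    qed auto
    then have "{i. i < n \<and> p i < n1} = {} \<or> {i. i < n \<and> p i < n1} = {..<n}" using nsp by blast
    \<comment> \<open>The preimage of \<open>0\<close> belongs to the row part and the preimage of
      \<open>n1\<close> does not, so the split is nontrivial. Both block sizes being positive enters
      here.\<close>
    moreover have onto: "\<exists>i<n. p i = c" if "c < n" for c
      using bij_betw_imp_surj_on[OF p] that by (metis imageE lessThan_iff)
    from onto[of 0] onto[of n1] obtain a b where "a < n" "p a = 0" "b < n" "p b = n1"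
      using n12 by auto
    ultimately show False using n12 by auto
  qed
  then show "proper_weighing_matrix n r M" using w unfolding proper_weighing_matrix_def by blast
qed

lemma proper_weighing_matrix_equivalent:
  assumes "proper_weighing_matrix n r N" "weighing_equivalent n M N"
  shows "proper_weighing_matrix n r M"
proof -
  have w: "weighing_matrix n r N" using assms(1) by (simp add: proper_weighing_matrix_def)
  have wM: "weighing_matrix n r M" by (rule weighing_matrix_equivalent[OF w assms(2)])
  have N: "N \<in> carrier_mat n n" by (rule weighing_matrix_carrier[OF w])
  have NM: "weighing_equivalent n N M" by (rule weighing_equivalent_sym[OF N assms(2)])
  show ?thesis
    unfolding proper_weighing_matrix_def
  proof (intro conjI wM notI, elim exE conjE)
    fix n1 r1 n2 r2 A B
    assume n: "0 < n1" "0 < n2" "n = n1 + n2"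
      and AB: "weighing_matrix n1 r1 A" "weighing_matrix n2 r2 B"
      and "weighing_equivalent n M (direct_sum_mat A B)"
    have "direct_sum_mat A B \<in> carrier_mat n n"
      unfolding n(3) by (rule direct_sum_mat_carrier[OF AB[THEN weighing_matrix_carrier]])
    then have "weighing_equivalent n N (direct_sum_mat A B)"
      using NM \<open>weighing_equivalent n M (direct_sum_mat A B)\<close> by (rule weighing_equivalent_trans)
    then show False using assms(1) n AB unfolding proper_weighing_matrix_def by metis
  qed
qed

text \<open>The condition on a class expressed for a single representative; it is invariant under
  equivalence, so any representative decides.\<close>

definition proper02 :: "nat \<Rightarrow> nat \<Rightarrow> real mat \<Rightarrow> bool" where
  "proper02 n r M \<longleftrightarrow> proper_weighing_matrix n r M \<and> rows_intersect_0_or_2 M"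

lemma proper02_weighing: "proper02 n r M \<Longrightarrow> weighing_matrix n r M"
  by (simp add: proper02_def proper_weighing_matrix_def)

lemma proper02_carrier: "proper02 n r M \<Longrightarrow> M \<in> carrier_mat n n"
  by (rule weighing_matrix_carrier[OF proper02_weighing])

lemma proper02_equivalent: "proper02 n r N \<Longrightarrow> weighing_equivalent n M N \<Longrightarrow> proper02 n r M"
  using proper_weighing_matrix_equivalent rows_intersect_0_or_2_equivalent[OF proper02_carrier]
  unfolding proper02_def by blast

text \<open>Transposition swaps the two sets of a split, and the overlap condition passes from rows
  to columns. Hence the transposes of an admissible class form an admissible class again.\<close>

lemma proper02_transpose:
  assumes "proper02 n r M" "0 < r"
  shows "proper02 n r (transpose_mat M)"
proof -
  note w = proper02_weighing[OF assms(1)]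
  have "proper_weighing_matrix n r (transpose_mat M)"
    using assms(1) unfolding proper02_def proper_weighing_matrix_iff[OF w assms(2)]
      proper_weighing_matrix_iff[OF weighing_matrix_transpose[OF w assms(2)] assms(2)]
      splits_transpose[OF proper02_carrier[OF assms(1)]] by blast
  moreover have "rows_intersect_0_or_2 (transpose_mat M)"
    using assms(1) rows_intersect_0_or_2_transpose[OF w assms(2)] by (simp add: proper02_def)
  ultimately show ?thesis by (simp add: proper02_def)
qed

section \<open>Symmetric matrices with two opposite eigenvalues\<close>

text \<open>Invariance of the trace under similarity: the trace of \<open>(P * B) * Q\<close> equals
  that of \<open>Q * (P * B)\<close>, and \<open>Q * P\<close> is the identity.\<close>

lemma diag_sum_similar:
  fixes A B :: "'a::comm_ring_1 mat"
  assumes A: "A \<in> carrier_mat m m" and sim: "similar_mat_wit A B P Q"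
  shows "(\<Sum>i<m. A $$ (i, i)) = (\<Sum>i<m. B $$ (i, i))"
proof -
  note S = similar_mat_witD2[OF A sim]
  have PB: "P * B \<in> carrier_mat m m" using S by simp
  have "(\<Sum>i<m. A $$ (i, i)) = (\<Sum>i<m. \<Sum>k<m. (P * B) $$ (i, k) * Q $$ (k, i))"
    unfolding S(3) using index_mult_mat_sum[OF PB S(7)] by simp
  also have "\<dots> = (\<Sum>k<m. \<Sum>i<m. Q $$ (k, i) * (P * B) $$ (i, k))"
    by (subst sum.swap) (simp add: mult.commute)
  also have "\<dots> = (\<Sum>k<m. (Q * (P * B)) $$ (k, k))"
    using index_mult_mat_sum[OF S(7) PB] by simp
  also have "Q * (P * B) = B"
    using S(2,5) assoc_mult_mat[OF S(7,6,5)] by simp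
  finally show ?thesis .
qed

lemma upper_triangular_square:
  fixes T :: "'a::comm_ring_1 mat"
  assumes T: "T \<in> carrier_mat m m" and ut: "upper_triangular T"
  shows "upper_triangular (T * T)" "i < m \<Longrightarrow> (T * T) $$ (i, i) = T $$ (i, i) ^ 2"
proof -
  have z: "T $$ (i, k) = 0" if "k < i" "i < m" for i k
    using ut T that by auto
  show "upper_triangular (T * T)"
  proof (rule upper_triangularI)
    fix i j assume "j < i" "i < dim_row (T * T)"
    then have ij: "j < i" "i < m" using T by auto
    have "(T * T) $$ (i, j) = (\<Sum>k<m. T $$ (i, k) * T $$ (k, j))"
      using ij by (intro index_mult_mat_sum[OF T T]) auto
    also have "\<dots> = 0"
    proof (rule sum.neutral, rule ballI)
      fix k assume "k \<in> {..<m}"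
      then show "T $$ (i, k) * T $$ (k, j) = 0"
        using z[of k i] z[of j k] ij by (cases "k < i") auto
    qed
    finally show "(T * T) $$ (i, j) = 0" .
  qed
  assume i: "i < m"
  have "(T * T) $$ (i, i) = (\<Sum>k<m. T $$ (i, k) * T $$ (k, i))"
    by (rule index_mult_mat_sum[OF T T i i])
  also have "\<dots> = (\<Sum>k\<in>{i}. T $$ (i, k) * T $$ (k, i))"
  proof (rule sum.mono_neutral_right)
    show "\<forall>k\<in>{..<m} - {i}. T $$ (i, k) * T $$ (k, i) = 0"
    proof
      fix k assume "k \<in> {..<m} - {i}"
      then show "T $$ (i, k) * T $$ (k, i) = 0"
        using z[of k i] z[of i k] i by (cases "k < i") auto
    qed
  qed (use i in auto)
  finally show "(T * T) $$ (i, i) = T $$ (i, i) ^ 2" by (simp add: power2_eq_square)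
qed

lemma mult_mat_vec_index_sum:
  assumes "A \<in> carrier_mat n m" "v \<in> carrier_vec m" "i < n"
  shows "(A *\<^sub>v v) $ i = (\<Sum>j<m. A $$ (i, j) * v $ j)"
  using assms by (auto simp: scalar_prod_def atLeast0LessThan intro!: sum.cong)

text \<open>Symmetry of the bilinear form of \<open>A\<close>. It is applied to the real and
  imaginary parts of a complex eigenvector.\<close>

lemma sum_symmetric_form:
  fixes x y :: "nat \<Rightarrow> real"
  assumes "\<And>i j. i < m \<Longrightarrow> j < m \<Longrightarrow> A $$ (i, j) = A $$ (j, i)"
  shows "(\<Sum>i<m. x i * (\<Sum>j<m. A $$ (i, j) * y j)) = (\<Sum>i<m. y i * (\<Sum>j<m. A $$ (i, j) * x j))"
proof -
  have "(\<Sum>i<m. x i * (\<Sum>j<m. A $$ (i, j) * y j)) = (\<Sum>i<m. \<Sum>j<m. x i * (A $$ (i, j) * y j))"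
    by (simp only: sum_distrib_left)
  also have "\<dots> = (\<Sum>j<m. \<Sum>i<m. x i * (A $$ (i, j) * y j))" by (rule sum.swap)
  also have "\<dots> = (\<Sum>j<m. \<Sum>i<m. y j * (A $$ (j, i) * x i))"
  proof (intro sum.cong refl)
    fix j i assume "j \<in> {..<m}" "i \<in> {..<m}"
    then show "x i * (A $$ (i, j) * y j) = y j * (A $$ (j, i) * x i)"
      using assms[of i j] by simp
  qed
  finally show ?thesis by (simp only: sum_distrib_left)
qed

text \<open>Schur triangularisation yields complex eigenvalues, while the hypothesis concerns the
  real spectrum. Write \<open>k = a + b i\<close> and \<open>v = x + y i\<close>. Then
  \<open>A x = a x - b y\<close> and \<open>A y = a y + b x\<close>, and symmetry of the form gives
  \<open>b (|x|^2 + |y|^2) = 0\<close>, hence \<open>b = 0\<close>.\<close>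

lemma complex_eigenvalue_symmetric:
  fixes A :: "real mat"
  assumes A: "A \<in> carrier_mat m m"
    and sym: "\<And>i j. i < m \<Longrightarrow> j < m \<Longrightarrow> A $$ (i, j) = A $$ (j, i)"
    and ev: "eigenvalue (map_mat complex_of_real A) k"
  shows "k \<in> complex_of_real ` spectrum A"
proof -
  obtain v where v: "v \<in> carrier_vec m" "v \<noteq> 0\<^sub>v m"
    and Av: "map_mat complex_of_real A *\<^sub>v v = k \<cdot>\<^sub>v v"
    using ev A by (auto simp: eigenvalue_def eigenvector_def)
  define x y where "x = vec m (\<lambda>i. Re (v $ i))" and "y = vec m (\<lambda>i. Im (v $ i))"
  have row: "(\<Sum>j<m. complex_of_real (A $$ (i, j)) * v $ j) = k * v $ i" if "i < m" for i
    using mult_mat_vec_index_sum[of "map_mat complex_of_real A" m m v i] A v(1) that Av by simp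
  have re: "(\<Sum>j<m. A $$ (i, j) * x $ j) = Re k * x $ i - Im k * y $ i" if "i < m" for i
    using arg_cong[OF row[OF that], of Re] that by (simp add: x_def y_def)
  have im: "(\<Sum>j<m. A $$ (i, j) * y $ j) = Re k * y $ i + Im k * x $ i" if "i < m" for i
    using arg_cong[OF row[OF that], of Im] that by (simp add: x_def y_def)
  obtain l where l: "l < m" "v $ l \<noteq> 0" using v by (auto simp: vec_eq_iff)
  have "(\<Sum>i<m. x $ i * (Re k * y $ i + Im k * x $ i)) = (\<Sum>i<m. y $ i * (Re k * x $ i - Im k * y $ i))"
    using sum_symmetric_form[OF sym, of m "\<lambda>i. x $ i" "\<lambda>i. y $ i"] re im by simp
  then have "(\<Sum>i<m. x $ i * (Re k * y $ i + Im k * x $ i) - y $ i * (Re k * x $ i - Im k * y $ i)) = 0"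
    by (simp add: sum_subtractf)
  then have "(\<Sum>i<m. Im k * ((x $ i)\<^sup>2 + (y $ i)\<^sup>2)) = 0"
    by (simp add: algebra_simps power2_eq_square)
  then have "Im k * (\<Sum>i<m. (x $ i)\<^sup>2 + (y $ i)\<^sup>2) = 0" by (simp only: sum_distrib_left)
  moreover have "0 < (\<Sum>i<m. (x $ i)\<^sup>2 + (y $ i)\<^sup>2)"
  proof (rule sum_pos2)
    show "0 < (x $ l)\<^sup>2 + (y $ l)\<^sup>2"
      using l by (auto simp: x_def y_def sum_power2_gt_zero_iff complex_eq_iff)
  qed (use l in auto)
  ultimately have "Im k = 0" by simp
  have eig: "eigenvalue A (Re k)" if "z \<in> carrier_vec m" "z \<noteq> 0\<^sub>v m"
    "\<And>i. i < m \<Longrightarrow> (\<Sum>j<m. A $$ (i, j) * z $ j) = Re k * z $ i" for z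
  proof -
    have "A *\<^sub>v z = Re k \<cdot>\<^sub>v z"
    proof (rule eq_vecI)
      fix i assume "i < dim_vec (Re k \<cdot>\<^sub>v z)"
      then show "(A *\<^sub>v z) $ i = (Re k \<cdot>\<^sub>v z) $ i"
        using mult_mat_vec_index_sum[OF A that(1), of i] that by simp
    qed (use A that in auto)
    then show ?thesis using A that by (auto simp: eigenvalue_def eigenvector_def)
  qed
  \<comment> \<open>Now that \<open>k\<close> is real, both parts satisfy the eigenvalue equation
    over the reals; whichever is nonzero is a real eigenvector.\<close>
  have "x \<noteq> 0\<^sub>v m \<or> y \<noteq> 0\<^sub>v m"
    using l by (auto simp: x_def y_def vec_eq_iff complex_eq_iff)
  then have "eigenvalue A (Re k)"
    using eig[of x] eig[of y] re im \<open>Im k = 0\<close> by (auto simp: x_def y_def)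
  then show ?thesis using \<open>Im k = 0\<close>
    by (auto simp: spectrum_def complex_eq_iff intro!: image_eqI[of _ _ "Re k"])
qed

text \<open>With \<open>B = A\<^sup>2\<close>, Schur triangularisation gives \<open>tr B = m \<theta>\<^sup>2\<close> and \<open>tr B\<^sup>2 = m \<theta>\<^sup>4\<close>,
  so the sum of the squared entries of \<open>B - \<theta>\<^sup>2 I\<close> vanishes.\<close>

lemma symmetric_two_eigenvalues_square:
  fixes A :: "real mat"
  assumes A: "A \<in> carrier_mat m m"
    and sym: "\<And>i j. i < m \<Longrightarrow> j < m \<Longrightarrow> A $$ (i, j) = A $$ (j, i)"
    and spec: "spectrum A \<subseteq> {\<theta>, -\<theta>}"
  shows "A * A = \<theta>\<^sup>2 \<cdot>\<^sub>m 1\<^sub>m m"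
proof -
  let ?c = "map_mat complex_of_real"
  define B where "B = A * A"
  have B: "B \<in> carrier_mat m m" using A by (simp add: B_def)
  have cA: "?c A \<in> carrier_mat m m" using A by simp
  obtain es where es: "char_poly (?c A) = (\<Prod>e\<leftarrow>es. [:- e, 1:])"
    using char_poly_factorized[OF cA] by auto
  obtain T P Q where sd: "schur_decomposition (?c A) es = (T, P, Q)"
    by (cases "schur_decomposition (?c A) es")
  have sim: "similar_mat_wit (?c A) T P Q" and ut: "upper_triangular T"
    using schur_decomposition[OF cA es sd] by simp_all
  have T: "T \<in> carrier_mat m m" using similar_mat_witD2[OF cA sim] by simp
  \<comment> \<open>Squaring removes the choice between the two eigenvalues, so their unknown
    multiplicities never enter.\<close>
  have diag: "(T $$ (i, i))\<^sup>2 = complex_of_real (\<theta>\<^sup>2)" if "i < m" for i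
  proof -
    have "char_poly T = (\<Prod>a\<leftarrow>diag_mat T. [:- a, 1:])"
      by (rule char_poly_upper_triangular[OF T ut])
    moreover have "T $$ (i, i) \<in> set (diag_mat T)" using that T by (auto simp: diag_mat_def)
    ultimately have "poly (char_poly T) (T $$ (i, i)) = 0"
      by (auto simp: poly_prod_list prod_list_zero_iff)
    moreover have "char_poly (?c A) = char_poly T"
      using sim by (intro char_poly_similar) (auto simp: similar_mat_def)
    ultimately have ev: "eigenvalue (?c A) (T $$ (i, i))"
      using eigenvalue_root_char_poly[OF cA] by simp
    have "T $$ (i, i) \<in> complex_of_real ` spectrum A"
      by (rule complex_eigenvalue_symmetric[OF A _ ev]) (rule sym)
    then have "T $$ (i, i) \<in> {complex_of_real \<theta>, - complex_of_real \<theta>}" using spec by auto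
    then show ?thesis by auto
  qed
  have sq: "similar_mat_wit (X * X) (Y * Y) P Q" if "similar_mat_wit X Y P Q" "X \<in> carrier_mat m m"
    for X Y :: "complex mat"
    using similar_mat_wit_pow[OF that(1), of 2] similar_mat_witD2[OF that(2,1)]
    by (simp add: numeral_2_eq_2)
  have cB: "?c B = ?c A * ?c A" unfolding B_def by (rule of_real_hom.mat_hom_mult[OF A A])
  have sim2: "similar_mat_wit (?c B) (T * T) P Q" unfolding cB by (rule sq[OF sim cA])
  have TT: "T * T \<in> carrier_mat m m" using T by simp
  have ccB: "?c B \<in> carrier_mat m m" using B by simp
  have "(\<Sum>i<m. ?c B $$ (i, i)) = (\<Sum>i<m. (T * T) $$ (i, i))"
    by (rule diag_sum_similar[OF ccB sim2])
  also have "\<dots> = complex_of_real (real m * \<theta>\<^sup>2)"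
    using upper_triangular_square(2)[OF T ut] diag by simp
  also have "(\<Sum>i<m. ?c B $$ (i, i)) = complex_of_real (\<Sum>i<m. B $$ (i, i))" using B by simp
  finally have tr: "(\<Sum>i<m. B $$ (i, i)) = real m * \<theta>\<^sup>2" by (simp only: of_real_eq_iff)
  \<comment> \<open>\<open>B\<close> is similar to \<open>T * T\<close>, so \<open>B * B\<close> is
    similar to the square of \<open>T * T\<close>. That factor is again upper triangular, so the
    diagonal consists of fourth powers of eigenvalues.\<close>
  have "(\<Sum>i<m. (?c B * ?c B) $$ (i, i)) = (\<Sum>i<m. ((T * T) * (T * T)) $$ (i, i))"
    using ccB by (intro diag_sum_similar[OF _ sq[OF sim2 ccB]]) simp
  also have "\<dots> = (\<Sum>i<m. ((T * T) $$ (i, i))\<^sup>2)"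
    using upper_triangular_square(2)[OF TT upper_triangular_square(1)[OF T ut]] by simp
  also have "\<dots> = complex_of_real (real m * (\<theta>\<^sup>2)\<^sup>2)"
    using upper_triangular_square(2)[OF T ut] diag by simp
  also have "?c B * ?c B = ?c (B * B)" by (rule of_real_hom.mat_hom_mult[OF B B, symmetric])
  also have "(\<Sum>i<m. ?c (B * B) $$ (i, i)) = complex_of_real (\<Sum>i<m. (B * B) $$ (i, i))"
    using B by simp
  finally have tr2: "(\<Sum>i<m. (B * B) $$ (i, i)) = real m * (\<theta>\<^sup>2)\<^sup>2" by (simp only: of_real_eq_iff)
  have symB: "B $$ (i, j) = B $$ (j, i)" if "i < m" "j < m" for i j
    unfolding B_def index_mult_mat_sum[OF A A that] index_mult_mat_sum[OF A A that(2,1)]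
    using sym that by (intro sum.cong) (simp_all add: mult.commute)
  define e where "e = (\<lambda>i j :: nat. if i = j then \<theta>\<^sup>2 else 0)"
  have "(\<Sum>i<m. \<Sum>j<m. (B $$ (i, j) - e i j)\<^sup>2) =
      (\<Sum>i<m. (B * B) $$ (i, i) - 2 * \<theta>\<^sup>2 * B $$ (i, i) + (\<theta>\<^sup>2)\<^sup>2)"
  proof (rule sum.cong)
    fix i assume "i \<in> {..<m}"
    then have i: "i < m" by simp
    have "(\<Sum>j<m. (B $$ (i, j) - e i j)\<^sup>2) =
        (\<Sum>j<m. B $$ (i, j) * B $$ (j, i) + (if i = j then (\<theta>\<^sup>2)\<^sup>2 - 2 * \<theta>\<^sup>2 * B $$ (i, j) else 0))"
      using symB i by (intro sum.cong) (auto simp: e_def power2_eq_square algebra_simps)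
    also have "\<dots> = (B * B) $$ (i, i) - 2 * \<theta>\<^sup>2 * B $$ (i, i) + (\<theta>\<^sup>2)\<^sup>2"
      using i by (simp add: sum.distrib index_mult_mat_sum[OF B B i i])
    finally show "(\<Sum>j<m. (B $$ (i, j) - e i j)\<^sup>2) = (B * B) $$ (i, i) - 2 * \<theta>\<^sup>2 * B $$ (i, i) + (\<theta>\<^sup>2)\<^sup>2" .
  qed simp
  \<comment> \<open>With \<open>t\<close> for the square of the eigenvalue, the two traces turn the
    sum into \<open>m t^2 - 2 t * m t + m t^2\<close>.\<close>
  also have "\<dots> = 0"
    by (simp add: sum.distrib sum_subtractf sum_distrib_left[symmetric] tr tr2 power2_eq_square)
  finally have "(\<Sum>i<m. \<Sum>j<m. (B $$ (i, j) - e i j)\<^sup>2) = 0" .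
  then have "\<forall>i<m. \<forall>j<m. B $$ (i, j) = e i j"
    by (simp add: sum_nonneg_eq_0_iff sum_nonneg)
  then show ?thesis unfolding B_def[symmetric]
    using B by (intro eq_matI) (auto simp: e_def)
qed

section \<open>Adjacency matrices of signed graphs\<close>

text \<open>The index convention from here on: position \<open>j < n\<close> stands for column
  \<open>j\<close> of \<open>M\<close>, position \<open>n + i\<close> for row
  \<open>i\<close>.\<close>

lemma index_bipartite_adj_mat:
  assumes "M \<in> carrier_mat n n" "i < n" "j < n"
  shows "bipartite_adj_mat M $$ (i, j) = 0"
    "bipartite_adj_mat M $$ (i, n + j) = M $$ (j, i)"
    "bipartite_adj_mat M $$ (n + i, j) = M $$ (i, j)"
    "bipartite_adj_mat M $$ (n + i, n + j) = 0"
  using assms by (auto simp: bipartite_adj_mat_def)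

lemma bipartite_adj_mat_carrier: "M \<in> carrier_mat n n \<Longrightarrow> bipartite_adj_mat M \<in> carrier_mat (2 * n) (2 * n)"
  by (auto simp: bipartite_adj_mat_def)

lemma less_double_cases:
  assumes "i < 2 * (n :: nat)"
  obtains (left) "i < n" | (right) k where "i = n + k" "k < n"
proof (cases "i < n")
  case False
  then show thesis using assms right[of "i - n"] by simp
qed (rule left)

lemma less_double: "l < n \<Longrightarrow> l < 2 * (n :: nat)"
  by simp

text \<open>Conjugation by an orthogonal matrix commutes with squaring and fixes multiples of the
  identity. In entries, the sign of the summation index occurs twice and cancels. This carries the
  square from the block matrix to every other listing of the graph.\<close>

lemma switching_equiv_square:
  assumes "switching_equiv m A B" and sq: "A * A = c \<cdot>\<^sub>m 1\<^sub>m m"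
  shows "B * B = c \<cdot>\<^sub>m 1\<^sub>m m"
proof -
  obtain p s where A: "A \<in> carrier_mat m m" and B: "B \<in> carrier_mat m m"
    and p: "bij_betw p {..<m} {..<m}" and s: "s \<in> {..<m} \<rightarrow> {1, -1}"
    and eq: "\<forall>i<m. \<forall>j<m. B $$ (i, j) = s i * s j * A $$ (p i, p j)"
    using assms(1) by (rule switching_equivE)
  have lt: "p i < m" if "i < m" for i using p that by (auto dest: bij_betwE)
  show ?thesis
  proof (rule eq_matI)
    fix i j assume "i < dim_row (c \<cdot>\<^sub>m 1\<^sub>m m)" "j < dim_col (c \<cdot>\<^sub>m 1\<^sub>m m)"
    then have ij: "i < m" "j < m" by simp_all
    have "(B * B) $$ (i, j) = (\<Sum>k<m. B $$ (i, k) * B $$ (k, j))"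
      by (rule index_mult_mat_sum[OF B B ij])
    also have "\<dots> = (\<Sum>k<m. s i * s j * (A $$ (p i, p k) * A $$ (p k, p j)))"
    proof (rule sum.cong)
      fix k assume k: "k \<in> {..<m}"
      then have "s k * s k = 1" using s by (intro pm1_mult_self) auto
      moreover have "B $$ (i, k) * B $$ (k, j) =
          (s k * s k) * (s i * s j * (A $$ (p i, p k) * A $$ (p k, p j)))"
        using eq ij k by (simp add: mult_ac)
      ultimately show "B $$ (i, k) * B $$ (k, j) = s i * s j * (A $$ (p i, p k) * A $$ (p k, p j))"
        by simp
    qed simp
    also have "\<dots> = s i * s j * (\<Sum>k<m. A $$ (p i, k) * A $$ (k, p j))"
      by (simp only: sum_distrib_left[symmetric]
          sum.reindex_bij_betw[OF p, of "\<lambda>k. A $$ (p i, k) * A $$ (k, p j)"])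
    also have "(\<Sum>k<m. A $$ (p i, k) * A $$ (k, p j)) = (A * A) $$ (p i, p j)"
      by (rule index_mult_mat_sum[symmetric, OF A A lt lt]) (rule ij)+
    also have "s i * s j * (A * A) $$ (p i, p j) = (c \<cdot>\<^sub>m 1\<^sub>m m) $$ (i, j)"
    proof (cases "i = j")
      case True
      moreover have "s j * s j = 1" using s ij by (intro pm1_mult_self) auto
      ultimately show ?thesis using sq lt ij by simp
    next
      case False
      then have "p i \<noteq> p j" using inj_onD[OF bij_betw_imp_inj_on[OF p], of i j] ij by auto
      then show ?thesis using sq lt ij False by simp
    qed
    finally show "(B * B) $$ (i, j) = (c \<cdot>\<^sub>m 1\<^sub>m m) $$ (i, j)" .
  qed (use B in auto)
qed

text \<open>The equation for the square forces each eigenvalue to be one of the two roots. That both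
  occur needs more, since a multiple of the identity has only one of them: this is the purpose of
  the zero diagonal entry.\<close>

lemma spectrum_of_square_root:
  fixes A :: "real mat"
  assumes A: "A \<in> carrier_mat m m" and "0 < m" "0 < c"
    and sq: "A * A = c \<cdot>\<^sub>m 1\<^sub>m m" and diag: "A $$ (0, 0) = 0"
  shows "spectrum A = {sqrt c, - sqrt c}"
proof -
  have AA: "A *\<^sub>v (A *\<^sub>v v) = c \<cdot>\<^sub>v v" if "v \<in> carrier_vec m" for v
  proof -
    have "A *\<^sub>v (A *\<^sub>v v) = (A * A) *\<^sub>v v" using A that by simp
    also have "\<dots> = c \<cdot>\<^sub>v v" unfolding sq using that by (intro eq_vecI) auto
    finally show ?thesis .
  qed
  have "k \<in> {sqrt c, - sqrt c}" if "eigenvalue A k" for k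
  proof -
    obtain v where v: "v \<in> carrier_vec m" "v \<noteq> 0\<^sub>v m" "A *\<^sub>v v = k \<cdot>\<^sub>v v"
      using \<open>eigenvalue A k\<close> A by (auto simp: eigenvalue_def eigenvector_def)
    have "c \<cdot>\<^sub>v v = A *\<^sub>v (k \<cdot>\<^sub>v v)" using AA[OF v(1)] v(3) by simp
    also have "\<dots> = k \<cdot>\<^sub>v (A *\<^sub>v v)" using A v(1) by (rule mult_mat_vec)
    finally have eq: "c \<cdot>\<^sub>v v = k \<cdot>\<^sub>v (k \<cdot>\<^sub>v v)" unfolding v(3) .
    obtain l where l: "l < m" "v $ l \<noteq> 0" using v(1,2) by (auto simp: vec_eq_iff)
    have "c * v $ l = k * (k * v $ l)" using arg_cong[OF eq, of "\<lambda>v. v $ l"] v(1) l(1) by simp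
    then have "k\<^sup>2 = (sqrt c)\<^sup>2" using l(2) \<open>0 < c\<close> by (simp add: power2_eq_square)
    then show ?thesis by (auto simp: power2_eq_iff)
  qed
  moreover have "eigenvalue A \<theta>" if \<theta>: "\<theta> \<in> {sqrt c, - sqrt c}" for \<theta>
  proof -
    define e :: "real vec" where "e = unit_vec m 0"
    have e: "e \<in> carrier_vec m" by (simp add: e_def)
    have c: "\<theta> * \<theta> = c" "\<theta> \<noteq> 0" using \<theta> \<open>0 < c\<close> by auto
    \<comment> \<open>Since \<open>(A - t I)(A + t I) = 0\<close> for either root \<open>t\<close>,
      the vector \<open>(A + t I) e\<close> satisfies the eigenvalue equation for \<open>t\<close>.
      Its entry \<open>0\<close> is \<open>t\<close> because the diagonal entry of \<open>A\<close>
      vanishes, so it is nonzero.\<close>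
    let ?v = "\<theta> \<cdot>\<^sub>v e + A *\<^sub>v e"
    have v: "?v \<in> carrier_vec m" using e A by simp
    have "(A *\<^sub>v e) $ 0 = A $$ (0, 0)"
      using A \<open>0 < m\<close> by (simp add: e_def)
    then have "?v $ 0 = \<theta>" using diag e A \<open>0 < m\<close> by (simp add: e_def)
    then have "?v \<noteq> 0\<^sub>v m" using c(2) \<open>0 < m\<close> by (metis index_zero_vec(1))
    moreover have "A *\<^sub>v ?v = \<theta> \<cdot>\<^sub>v ?v"
    proof -
      have "A *\<^sub>v ?v = A *\<^sub>v (\<theta> \<cdot>\<^sub>v e) + A *\<^sub>v (A *\<^sub>v e)"
        using A e by (intro mult_add_distrib_mat_vec) auto
      also have "A *\<^sub>v (\<theta> \<cdot>\<^sub>v e) = \<theta> \<cdot>\<^sub>v (A *\<^sub>v e)" using A e by (rule mult_mat_vec)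
      also have "A *\<^sub>v (A *\<^sub>v e) = (\<theta> * \<theta>) \<cdot>\<^sub>v e" using AA[OF e] c by simp
      also have "\<theta> \<cdot>\<^sub>v (A *\<^sub>v e) + (\<theta> * \<theta>) \<cdot>\<^sub>v e = \<theta> \<cdot>\<^sub>v ?v"
        using A e by (intro eq_vecI) (auto simp: algebra_simps)
      finally show ?thesis .
    qed
    ultimately show ?thesis using A v by (auto simp: eigenvalue_def eigenvector_def)
  qed
  ultimately show ?thesis unfolding spectrum_def by blast
qed

text \<open>One listing is fixed so that every graph predicate becomes a condition on matrix
  entries. The order \<open>m\<close> is a parameter of its own, to be instantiated to
  \<open>2 * n\<close>.\<close>

locale listed_sgraph =
  fixes G :: "'a sgraph" and vs :: "'a list" and m :: nat and A :: "real mat"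
  assumes signed: "signed_graph G" and distinct_vs: "distinct vs" and set_vs: "set vs = verts G"
    and length_vs: "length vs = m" and A_def: "A = adj_mat_of_list G vs"
begin

lemma carrier_A: "A \<in> carrier_mat m m"
  by (simp add: A_def adj_mat_of_list_def length_vs)

lemma index_A:
  "i < m \<Longrightarrow> j < m \<Longrightarrow> A $$ (i, j) = (if {vs ! i, vs ! j} \<in> edges G then sign G {vs ! i, vs ! j} else 0)"
  by (simp add: A_def adj_mat_of_list_def length_vs)

lemma A_nonzero_iff: "i < m \<Longrightarrow> j < m \<Longrightarrow> A $$ (i, j) \<noteq> 0 \<longleftrightarrow> {vs ! i, vs ! j} \<in> edges G"
proof -
  have "sign G e \<noteq> 0" if "e \<in> edges G" for e
  proof -
    have "sign G e \<in> {1, -1}" using signed that by (simp add: signed_graph_def)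
    then show ?thesis by auto
  qed
  then show "i < m \<Longrightarrow> j < m \<Longrightarrow> A $$ (i, j) \<noteq> 0 \<longleftrightarrow> {vs ! i, vs ! j} \<in> edges G"
    by (simp add: index_A)
qed

lemma A_entries: "i < m \<Longrightarrow> j < m \<Longrightarrow> A $$ (i, j) \<in> {0, 1, -1}"
  using signed by (auto simp: index_A signed_graph_def)

lemma A_sym: "i < m \<Longrightarrow> j < m \<Longrightarrow> A $$ (i, j) = A $$ (j, i)"
  by (simp add: index_A insert_commute)

lemma A_diag: "i < m \<Longrightarrow> A $$ (i, i) = 0"
  using signed by (auto simp: index_A signed_graph_def)

lemma nth_vs_in: "i < m \<Longrightarrow> vs ! i \<in> verts G"
  using set_vs length_vs nth_mem by blast

lemma verts_nthE:
  assumes "v \<in> verts G"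
  obtains i where "i < m" "v = vs ! i"
  using assms set_vs length_vs by (metis in_set_conv_nth)

lemma edge_nthE:
  assumes "e \<in> edges G"
  obtains i j where "i < m" "j < m" "e = {vs ! i, vs ! j}" "A $$ (i, j) \<noteq> 0"
proof -
  have "card e = 2" "e \<subseteq> verts G" using assms signed by (auto simp: signed_graph_def)
  then obtain u v where e: "e = {u, v}" "u \<in> verts G" "v \<in> verts G" by (auto simp: card_2_iff)
  obtain i where i: "i < m" "u = vs ! i" using e(2) by (rule verts_nthE)
  obtain j where j: "j < m" "v = vs ! j" using e(3) by (rule verts_nthE)
  show thesis using that[of i j] i j e assms by (simp add: A_nonzero_iff)
qed

lemma edge_in_verts: "{u, v} \<in> edges G \<Longrightarrow> u \<in> verts G \<and> v \<in> verts G"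
  using signed by (auto simp: signed_graph_def)

lemma inj_nth_vs: "inj_on ((!) vs) {..<m}"
  using distinct_vs length_vs by (auto simp: inj_on_def nth_eq_iff_index_eq)

lemma bij_nth_vs: "bij_betw ((!) vs) {..<m} (verts G)"
  using bij_betw_nth[OF distinct_vs, of "{..<m}" "verts G"] length_vs set_vs by simp

lemma card_verts: "card (verts G) = m"
  using bij_betw_same_card[OF bij_nth_vs] by simp

lemma neighbours_nth: "i < m \<Longrightarrow> neighbours G (vs ! i) = (!) vs ` {j. j < m \<and> A $$ (i, j) \<noteq> 0}"
  by (auto simp: neighbours_def A_nonzero_iff nth_vs_in elim: verts_nthE)

lemma card_neighbours:
  assumes "i < m"
  shows "card (neighbours G (vs ! i)) = card {j. j < m \<and> A $$ (i, j) \<noteq> 0}"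
  unfolding neighbours_nth[OF assms] by (rule card_image[OF inj_on_subset[OF inj_nth_vs]]) auto

lemma card_common_neighbours:
  assumes "i < m" "j < m"
  shows "card (neighbours G (vs ! i) \<inter> neighbours G (vs ! j)) =
    card {k. k < m \<and> A $$ (i, k) \<noteq> 0 \<and> A $$ (j, k) \<noteq> 0}"
proof -
  have "neighbours G (vs ! i) \<inter> neighbours G (vs ! j) =
      (!) vs ` ({k. k < m \<and> A $$ (i, k) \<noteq> 0} \<inter> {k. k < m \<and> A $$ (j, k) \<noteq> 0})"
    unfolding neighbours_nth[OF assms(1)] neighbours_nth[OF assms(2)]
    by (rule inj_on_image_Int[OF inj_nth_vs, symmetric]) auto
  also have "{k. k < m \<and> A $$ (i, k) \<noteq> 0} \<inter> {k. k < m \<and> A $$ (j, k) \<noteq> 0} =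
      {k. k < m \<and> A $$ (i, k) \<noteq> 0 \<and> A $$ (j, k) \<noteq> 0}" by auto
  finally show ?thesis by (simp add: card_image[OF inj_on_subset[OF inj_nth_vs]] subset_iff)
qed

text \<open>Connectedness without paths, in the shape that matches \<open>splits\<close>. A path
  cannot leave a closed index set, and the indices reachable from a given vertex form a closed
  set.\<close>

lemma connected_iff:
  "connected_sgraph G \<longleftrightarrow> 0 < m \<and> (\<forall>K\<subseteq>{..<m}.
     (\<forall>i<m. \<forall>j<m. A $$ (i, j) \<noteq> 0 \<longrightarrow> (i \<in> K \<longleftrightarrow> j \<in> K)) \<longrightarrow> K = {} \<or> K = {..<m})"
    (is "_ \<longleftrightarrow> _ \<and> (\<forall>K\<subseteq>_. ?closed K \<longrightarrow> _)")
proof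
  let ?E = "{(x, y). {x, y} \<in> edges G}"
  assume con: "connected_sgraph G"
  then have "verts G \<noteq> {}" by (simp add: connected_sgraph_def)
  then have "0 < m" using set_vs length_vs by (cases vs) auto
  moreover have "K = {} \<or> K = {..<m}" if K: "K \<subseteq> {..<m}" and closed: "?closed K" for K
  proof (rule ccontr)
    assume "\<not> (K = {} \<or> K = {..<m})"
    then obtain i j where ij: "i \<in> K" "j < m" "j \<notin> K" using K by blast
    have reach: "v \<in> (!) vs ` K" if "(vs ! i, v) \<in> ?E\<^sup>*" for v
      using that
    proof (induction rule: rtrancl_induct)
      case base
      then show ?case using ij by simp
    next
      case (step y z)
      then obtain k where k: "k \<in> K" "y = vs ! k" by blast
      have e: "{y, z} \<in> edges G" using step by simp
      then obtain l where l: "l < m" "z = vs ! l" using edge_in_verts verts_nthE by metis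
      have "k < m" using k K by blast
      then have "A $$ (k, l) \<noteq> 0" using e k l by (simp add: A_nonzero_iff)
      then show ?case using closed k l \<open>k < m\<close> by blast
    qed
    have "i < m" using ij K by blast
    then have "(vs ! i, vs ! j) \<in> ?E\<^sup>*"
      using con nth_vs_in ij unfolding connected_sgraph_def by blast
    then obtain k where "k \<in> K" "vs ! j = vs ! k" using reach by blast
    then show False using inj_onD[OF inj_nth_vs, of j k] ij K by auto
  qed
  ultimately show "0 < m \<and> (\<forall>K\<subseteq>{..<m}. ?closed K \<longrightarrow> K = {} \<or> K = {..<m})" by blast
next
  let ?E = "{(x, y). {x, y} \<in> edges G}"
  assume R: "0 < m \<and> (\<forall>K\<subseteq>{..<m}. ?closed K \<longrightarrow> K = {} \<or> K = {..<m})"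
  have "(u, v) \<in> ?E\<^sup>*" if uv: "u \<in> verts G" "v \<in> verts G" for u v
  proof -
    define K where "K = {k. k < m \<and> (u, vs ! k) \<in> ?E\<^sup>*}"
    have step: "j \<in> K" if "i \<in> K" "j < m" "A $$ (i, j) \<noteq> 0" for i j
    proof -
      have "i < m" "(u, vs ! i) \<in> ?E\<^sup>*" using that by (simp_all add: K_def)
      moreover have "(vs ! i, vs ! j) \<in> ?E" using that A_nonzero_iff[OF \<open>i < m\<close>] by simp
      ultimately have "(u, vs ! j) \<in> ?E\<^sup>*" by (meson rtrancl.rtrancl_into_rtrancl)
      then show ?thesis using that by (simp add: K_def)
    qed
    \<comment> \<open>\<open>step\<close> closes \<open>K\<close> in one direction only; symmetry of
      \<open>A\<close> supplies the other.\<close>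
    have "?closed K" using step A_sym by metis
    moreover have "K \<subseteq> {..<m}" by (auto simp: K_def)
    moreover obtain i where "i < m" "u = vs ! i" using uv(1) by (rule verts_nthE)
    then have "K \<noteq> {}" by (auto simp: K_def)
    ultimately have "K = {..<m}" using R by blast
    moreover obtain j where "j < m" "v = vs ! j" using uv(2) by (rule verts_nthE)
    ultimately show ?thesis by (auto simp: K_def)
  qed
  moreover have "verts G \<noteq> {}" using R set_vs length_vs by auto
  ultimately show "connected_sgraph G" by (simp add: connected_sgraph_def)
qed

end

section \<open>Independence of the vertex listing\<close>

lemma adjacency_matrixE:
  assumes "adjacency_matrix G A" "signed_graph G"
  obtains vs where "listed_sgraph G vs (card (verts G)) A"
proof -
  obtain vs where "distinct vs" "set vs = verts G" "A = adj_mat_of_list G vs"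
    using assms(1) by (auto simp: adjacency_matrix_def)
  then show thesis using that[of vs] assms(2) distinct_card[of vs] by (simp add: listed_sgraph_def)
qed

lemma (in listed_sgraph) adjacency: "adjacency_matrix G A"
  using distinct_vs set_vs A_def by (auto simp: adjacency_matrix_def)

lemma adjacency_matrix_switching_equiv:
  assumes G: "signed_graph G" and A: "adjacency_matrix G A" and B: "adjacency_matrix G B"
  shows "switching_equiv (card (verts G)) A B"
proof -
  let ?m = "card (verts G)"
  obtain vs where "listed_sgraph G vs ?m A" using A G by (rule adjacency_matrixE)
  then interpret V: listed_sgraph G vs ?m A .
  obtain ws where "listed_sgraph G ws ?m B" using B G by (rule adjacency_matrixE)
  then interpret W: listed_sgraph G ws ?m B .
  \<comment> \<open>A position in \<open>ws\<close> goes to the position of the same vertex in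
    \<open>vs\<close>. Both matrices record the same signs, so all switching signs are 1.\<close>
  define p where "p = inv_into {..<?m} ((!) vs) \<circ> (!) ws"
  have p: "bij_betw p {..<?m} {..<?m}"
    unfolding p_def by (rule bij_betw_trans[OF W.bij_nth_vs bij_betw_inv_into[OF V.bij_nth_vs]])
  have nth: "vs ! p i = ws ! i" if "i < ?m" for i
    using bij_betw_inv_into_right[OF V.bij_nth_vs W.nth_vs_in[OF that]] by (simp add: p_def)
  have lt: "p i < ?m" if "i < ?m" for i using p that by (auto dest: bij_betwE)
  have one: "(\<lambda>_. 1 :: real) \<in> {..<?m} \<rightarrow> {1, -1}" by simp
  show ?thesis
    by (rule switching_equivI[OF V.carrier_A W.carrier_A p one])
      (simp add: V.index_A W.index_A lt nth)
qed

text \<open>The definition provides some pair of adjacency matrices; here any pair may be chosen.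
  Relabellings at both ends, composed with the given switching, connect the chosen pair.\<close>

lemma switching_isomorphic_iff:
  assumes G: "signed_graph G" and A: "adjacency_matrix G A"
    and H: "signed_graph H" and B: "adjacency_matrix H B"
  shows "switching_isomorphic G H \<longleftrightarrow> switching_equiv (card (verts G)) A B"
proof
  let ?m = "card (verts G)"
  have car: "A' \<in> carrier_mat ?m ?m" if "adjacency_matrix G A'" for A'
    using adjacency_matrix_switching_equiv[OF G that that] by (simp add: switching_equiv_def)
  assume "switching_isomorphic G H"
  then obtain A' B' Q where A': "adjacency_matrix G A'" and B': "adjacency_matrix H B'"
    and Q: "signed_permutation_matrix (dim_row A') Q" "B' = transpose_mat Q * A' * Q"
    by (auto simp: switching_isomorphic_def)
  have "dim_row A' = ?m" using car[OF A'] by simp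
  then have "\<exists>Q. signed_permutation_matrix ?m Q \<and> B' = transpose_mat Q * A' * Q" using Q by auto
  then have AB': "switching_equiv ?m A' B'" unfolding switching_equiv_iff[OF car[OF A']] .
  \<comment> \<open>\<open>B'\<close> has order \<open>card (verts H)\<close> as a matrix of
    \<open>H\<close> and order \<open>card (verts G)\<close> by \<open>AB'\<close>, so both graphs
    have equally many vertices.\<close>
  have "switching_equiv (card (verts H)) B' B" by (rule adjacency_matrix_switching_equiv[OF H B' B])
  moreover from this AB' have "card (verts H) = ?m" by (auto simp: switching_equiv_def)
  ultimately have "switching_equiv ?m B' B" by simp
  then show "switching_equiv ?m A B"
    by (rule switching_equiv_trans[OF switching_equiv_trans[OF adjacency_matrix_switching_equiv[OF G A A'] AB']])
next
  let ?m = "card (verts G)"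
  assume AB: "switching_equiv ?m A B"
  then have car: "A \<in> carrier_mat ?m ?m" by (simp add: switching_equiv_def)
  obtain Q where "signed_permutation_matrix ?m Q" "B = transpose_mat Q * A * Q"
    using AB unfolding switching_equiv_iff[OF car, symmetric] by auto
  then show "switching_isomorphic G H"
    using A B car unfolding switching_isomorphic_def
    by (intro exI[of _ A] exI[of _ B] exI[of _ Q]) simp
qed

section \<open>Bipartite signed graphs of weighing matrices\<close>

text \<open>Links the diagonal of the weighing identity with vertex degrees, in both directions of
  the correspondence.\<close>

lemma sum_squares_eq_card:
  fixes x :: "nat \<Rightarrow> real"
  assumes "\<And>i. i < n \<Longrightarrow> x i \<in> {0, 1, -1}"
  shows "(\<Sum>i<n. x i * x i) = real (card {i. i < n \<and> x i \<noteq> 0})"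
proof -
  have "(\<Sum>i<n. x i * x i) = (\<Sum>i\<in>{i. i < n \<and> x i \<noteq> 0}. 1)"
  proof (rule sum.mono_neutral_cong_right)
    fix i assume "i \<in> {i. i < n \<and> x i \<noteq> 0}"
    then have "x i \<in> {1, -1}" using assms[of i] by auto
    then show "x i * x i = 1" by (rule pm1_mult_self)
  qed auto
  then show ?thesis by simp
qed

lemma weighing_matrix_col_card:
  assumes w: "weighing_matrix n r M" and j: "j < n"
  shows "card {i. i < n \<and> M $$ (i, j) \<noteq> 0} = r"
proof -
  have "(\<Sum>i<n. M $$ (i, j) * M $$ (i, j)) = real r"
    using w j by (simp add: weighing_matrix_iff)
  then show ?thesis
    using sum_squares_eq_card[of n "\<lambda>i. M $$ (i, j)"] w j by (simp add: weighing_matrix_def)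
qed

lemma weighing_matrix_row_card:
  assumes w: "weighing_matrix n r M" and "0 < r" and i: "i < n"
  shows "card {j. j < n \<and> M $$ (i, j) \<noteq> 0} = r"
proof -
  have "{j. j < n \<and> M $$ (i, j) \<noteq> 0} = {j. j < n \<and> transpose_mat M $$ (j, i) \<noteq> 0}"
    using i weighing_matrix_carrier[OF w] by auto
  then show ?thesis
    using weighing_matrix_col_card[OF weighing_matrix_transpose[OF w \<open>0 < r\<close>] i] by simp
qed

lemma card_shift: "card {k. k < 2 * n \<and> n \<le> k \<and> P (k - n)} = card {i. i < (n :: nat) \<and> P i}"
proof -
  have "{k. k < 2 * n \<and> n \<le> k \<and> P (k - n)} = (+) n ` {i. i < n \<and> P i}" (is "?A = ?B")
  proof
    show "?A \<subseteq> ?B"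
    proof
      fix k assume "k \<in> ?A"
      then show "k \<in> ?B" by (intro image_eqI[of _ _ "k - n"]) auto
    qed
  qed auto
  then show ?thesis by (simp add: card_image)
qed

lemma bipartite_adj_mat_square:
  assumes w: "weighing_matrix n r M" and "0 < r"
  shows "bipartite_adj_mat M * bipartite_adj_mat M = real r \<cdot>\<^sub>m 1\<^sub>m (2 * n)"
proof -
  have M: "M \<in> carrier_mat n n" by (rule weighing_matrix_carrier[OF w])
  have MT: "transpose_mat M \<in> carrier_mat n n" using M by simp
  have "M * transpose_mat M = real r \<cdot>\<^sub>m 1\<^sub>m n"
    using weighing_matrix_transpose[OF w \<open>0 < r\<close>] by (simp add: weighing_matrix_def)
  moreover have "transpose_mat M * M = real r \<cdot>\<^sub>m 1\<^sub>m n" using w by (simp add: weighing_matrix_def)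
  moreover have "bipartite_adj_mat M = four_block_mat (0\<^sub>m n n) (transpose_mat M) M (0\<^sub>m n n)"
    using M by (auto simp: bipartite_adj_mat_def)
  ultimately have "bipartite_adj_mat M * bipartite_adj_mat M =
      four_block_mat (real r \<cdot>\<^sub>m 1\<^sub>m n) (0\<^sub>m n n) (0\<^sub>m n n) (real r \<cdot>\<^sub>m 1\<^sub>m n)"
    using M MT by (simp add: mult_four_block_mat[of _ n n _ n _ n _ _ n _ n])
  also have "\<dots> = real r \<cdot>\<^sub>m 1\<^sub>m (2 * n)" by (intro eq_matI) auto
  finally show ?thesis .
qed

locale bipartite_listing = listed_sgraph G vs "2 * n" "bipartite_adj_mat M"
  for G :: "'a sgraph" and vs n M +
  assumes carrier_M: "M \<in> carrier_mat n n"
begin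

lemma left_nonzero_iff:
  assumes "j < n" "k < 2 * n"
  shows "bipartite_adj_mat M $$ (j, k) \<noteq> 0 \<longleftrightarrow> n \<le> k \<and> M $$ (k - n, j) \<noteq> 0"
  using assms(2)
proof (cases rule: less_double_cases)
  case left
  then show ?thesis using index_bipartite_adj_mat(1)[OF carrier_M assms(1)] by simp
next
  case (right i)
  then show ?thesis using index_bipartite_adj_mat(2)[OF carrier_M assms(1)] by simp
qed

lemma right_nonzero_iff:
  assumes "i < n" "k < 2 * n"
  shows "bipartite_adj_mat M $$ (n + i, k) \<noteq> 0 \<longleftrightarrow> k < n \<and> M $$ (i, k) \<noteq> 0"
  using assms(2)
proof (cases rule: less_double_cases)
  case left
  then show ?thesis using index_bipartite_adj_mat(3)[OF carrier_M assms(1)] by simp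
next
  case (right j)
  then show ?thesis using index_bipartite_adj_mat(4)[OF carrier_M assms(1)] by simp
qed

lemma left_set: "j < n \<Longrightarrow>
    {k. k < 2 * n \<and> bipartite_adj_mat M $$ (j, k) \<noteq> 0 \<and> P k} =
    {k. k < 2 * n \<and> n \<le> k \<and> M $$ (k - n, j) \<noteq> 0 \<and> P k}"
  using left_nonzero_iff by blast

lemma right_set: "i < n \<Longrightarrow>
    {k. k < 2 * n \<and> bipartite_adj_mat M $$ (n + i, k) \<noteq> 0 \<and> P k} = {k. k < n \<and> M $$ (i, k) \<noteq> 0 \<and> P k}"
  using right_nonzero_iff less_double by blast

lemma card_neighbours_left:
  assumes "j < n"
  shows "card (neighbours G (vs ! j)) = card {i. i < n \<and> M $$ (i, j) \<noteq> 0}"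
  using assms card_neighbours[of j] left_set[OF assms, of "\<lambda>_. True"]
    card_shift[of n "\<lambda>i. M $$ (i, j) \<noteq> 0"] by simp

lemma card_neighbours_right:
  assumes "i < n"
  shows "card (neighbours G (vs ! (n + i))) = card {j. j < n \<and> M $$ (i, j) \<noteq> 0}"
  using assms card_neighbours[of "n + i"] right_set[OF assms, of "\<lambda>_. True"] by simp

lemma card_common_left:
  assumes "j < n" "k < n"
  shows "card (neighbours G (vs ! j) \<inter> neighbours G (vs ! k)) =
    card {i. i < n \<and> M $$ (i, j) \<noteq> 0 \<and> M $$ (i, k) \<noteq> 0}"
proof -
  have "{l. l < 2 * n \<and> bipartite_adj_mat M $$ (j, l) \<noteq> 0 \<and> bipartite_adj_mat M $$ (k, l) \<noteq> 0} =
      {l. l < 2 * n \<and> n \<le> l \<and> M $$ (l - n, j) \<noteq> 0 \<and> M $$ (l - n, k) \<noteq> 0}"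
    using left_nonzero_iff[OF assms(1)] left_nonzero_iff[OF assms(2)] by blast
  then show ?thesis
    using assms card_common_neighbours[of j k]
      card_shift[of n "\<lambda>i. M $$ (i, j) \<noteq> 0 \<and> M $$ (i, k) \<noteq> 0"] by simp
qed

lemma card_common_right:
  assumes "i < n" "k < n"
  shows "card (neighbours G (vs ! (n + i)) \<inter> neighbours G (vs ! (n + k))) =
    card {j. j < n \<and> M $$ (i, j) \<noteq> 0 \<and> M $$ (k, j) \<noteq> 0}"
proof -
  have "{l. l < 2 * n \<and> bipartite_adj_mat M $$ (n + i, l) \<noteq> 0 \<and> bipartite_adj_mat M $$ (n + k, l) \<noteq> 0} =
      {l. l < n \<and> M $$ (i, l) \<noteq> 0 \<and> M $$ (k, l) \<noteq> 0}"
    using right_nonzero_iff[OF assms(1)] right_nonzero_iff[OF assms(2)] less_double by blast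
  then show ?thesis
    using assms card_common_neighbours[of "n + i" "n + k"] by simp
qed

lemma card_common_mixed:
  assumes "j < n" "i < n"
  shows "card (neighbours G (vs ! j) \<inter> neighbours G (vs ! (n + i))) = 0"
proof -
  have "{l. l < 2 * n \<and> bipartite_adj_mat M $$ (j, l) \<noteq> 0 \<and> bipartite_adj_mat M $$ (n + i, l) \<noteq> 0} = {}"
    using left_nonzero_iff[OF assms(1)] right_nonzero_iff[OF assms(2)] by fastforce
  then show ?thesis
    using assms card_common_neighbours[of j "n + i"] by (simp only:) simp
qed

lemma regular_iff:
  "regular_sgraph r G \<longleftrightarrow> (\<forall>j<n. card {i. i < n \<and> M $$ (i, j) \<noteq> 0} = r) \<and>
     (\<forall>i<n. card {j. j < n \<and> M $$ (i, j) \<noteq> 0} = r)"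
proof
  assume "regular_sgraph r G"
  then have "card (neighbours G (vs ! k)) = r" if "k < 2 * n" for k
    using nth_vs_in[OF that] by (simp add: regular_sgraph_def)
  then show "(\<forall>j<n. card {i. i < n \<and> M $$ (i, j) \<noteq> 0} = r) \<and>
     (\<forall>i<n. card {j. j < n \<and> M $$ (i, j) \<noteq> 0} = r)"
    using card_neighbours_left card_neighbours_right by simp
next
  assume R: "(\<forall>j<n. card {i. i < n \<and> M $$ (i, j) \<noteq> 0} = r) \<and>
     (\<forall>i<n. card {j. j < n \<and> M $$ (i, j) \<noteq> 0} = r)"
  have "card (neighbours G (vs ! k)) = r" if "k < 2 * n" for k
    using that
  proof (cases rule: less_double_cases)
    case left
    then show ?thesis using R card_neighbours_left by simp
  next
    case (right i)
    then show ?thesis using R card_neighbours_right by simp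
  qed
  then show "regular_sgraph r G"
    unfolding regular_sgraph_def by (metis verts_nthE)
qed

text \<open>The bridge between proper matrices and connected graphs. A closed index set
  \<open>K\<close> and a split carry the same data: \<open>K\<close> is \<open>C\<close> on the
  first \<open>n\<close> positions and \<open>R\<close> shifted by \<open>n\<close> on the
  others.\<close>

lemma connected_iff_splits:
  "connected_sgraph G \<longleftrightarrow> 0 < n \<and>
    (\<forall>R C. splits n M R C \<longrightarrow> R = {} \<and> C = {} \<or> R = {..<n} \<and> C = {..<n})"
proof
  assume con: "connected_sgraph G"
  then have "0 < n" by (simp add: connected_iff)
  moreover have "R = {} \<and> C = {} \<or> R = {..<n} \<and> C = {..<n}" if sp: "splits n M R C" for R C
  proof -
    have R: "R \<subseteq> {..<n}" and C: "C \<subseteq> {..<n}" using sp by (simp_all add: splits_def)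
    define K where "K = C \<union> (+) n ` R"
    have Kl: "j \<in> K \<longleftrightarrow> j \<in> C" if "j < n" for j using that by (auto simp: K_def)
    have Kr: "n + i \<in> K \<longleftrightarrow> i \<in> R" for i using C by (auto simp: K_def)
    have K: "K \<subseteq> {..<2 * n}" using R C by (auto simp: K_def)
    have "\<forall>k<2 * n. \<forall>l<2 * n. bipartite_adj_mat M $$ (k, l) \<noteq> 0 \<longrightarrow> (k \<in> K \<longleftrightarrow> l \<in> K)"
    proof (intro allI impI)
      fix k l assume kl: "k < 2 * n" "l < 2 * n" and nz: "bipartite_adj_mat M $$ (k, l) \<noteq> 0"
      from kl(1) show "k \<in> K \<longleftrightarrow> l \<in> K"
      proof (cases rule: less_double_cases)
        case left
        then have l: "n \<le> l" "M $$ (l - n, k) \<noteq> 0" using left_nonzero_iff kl nz by auto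
        then have "l - n \<in> R \<longleftrightarrow> k \<in> C" using sp left kl by (simp add: splits_def)
        then show ?thesis using Kl[OF left] Kr[of "l - n"] l by simp
      next
        case (right i)
        then have l: "l < n" "M $$ (i, l) \<noteq> 0" using right_nonzero_iff kl nz by auto
        then have "i \<in> R \<longleftrightarrow> l \<in> C" using sp right by (simp add: splits_def)
        then show ?thesis using Kl[OF l(1)] Kr[of i] right by simp
      qed
    qed
    then have "K = {} \<or> K = {..<2 * n}" using con K by (simp add: connected_iff)
    then show ?thesis
    proof
      assume "K = {}"
      then show ?thesis by (simp add: K_def)
    next
      assume full: "K = {..<2 * n}"
      have "i \<in> R" "i \<in> C" if "i < n" for i using Kl[OF that] Kr[of i] full that by simp_all
      then show ?thesis using R C by blast
    qed
  qed
  ultimately show "0 < n \<and> (\<forall>R C. splits n M R C \<longrightarrow> R = {} \<and> C = {} \<or> R = {..<n} \<and> C = {..<n})"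
    by blast
next
  assume H: "0 < n \<and> (\<forall>R C. splits n M R C \<longrightarrow> R = {} \<and> C = {} \<or> R = {..<n} \<and> C = {..<n})"
  have "K = {} \<or> K = {..<2 * n}" if K: "K \<subseteq> {..<2 * n}"
    and closed: "\<forall>k<2 * n. \<forall>l<2 * n. bipartite_adj_mat M $$ (k, l) \<noteq> 0 \<longrightarrow> (k \<in> K \<longleftrightarrow> l \<in> K)" for K
  proof -
    define R C where "R = {i. i < n \<and> n + i \<in> K}" and "C = {j. j < n \<and> j \<in> K}"
    have "splits n M R C"
      unfolding splits_def
    proof (intro conjI allI impI)
      fix i j assume ij: "i < n" "j < n" and "M $$ (i, j) \<noteq> 0"
      then have "bipartite_adj_mat M $$ (n + i, j) \<noteq> 0" using right_nonzero_iff[of i j] by simp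
      then have "n + i \<in> K \<longleftrightarrow> j \<in> K" using closed ij by simp
      then show "i \<in> R \<longleftrightarrow> j \<in> C" using ij by (simp add: R_def C_def)
    qed (auto simp: R_def C_def)
    then consider "R = {}" "C = {}" | "R = {..<n}" "C = {..<n}" using H by blast
    then show ?thesis
    proof cases
      case 1
      have "k \<notin> K" if "k < 2 * n" for k
        using that by (cases rule: less_double_cases) (use 1 in \<open>auto simp: R_def C_def\<close>)
      then show ?thesis using K by blast
    next
      case 2
      have "k \<in> K" if "k < 2 * n" for k
        using that by (cases rule: less_double_cases) (use 2 in \<open>auto simp: R_def C_def\<close>)
      then show ?thesis using K by blast
    qed
  qed
  then show "connected_sgraph G" using H by (simp add: connected_iff)
qed

text \<open>Each edge changes sides. This yields bipartiteness, and also the absence of triangles,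
  since a closed walk of length three would change sides three times.\<close>

lemma edge_sides:
  assumes "{u, v} \<in> edges G"
  shows "u \<in> (!) vs ` {..<n} \<longleftrightarrow> v \<notin> (!) vs ` {..<n}"
proof -
  obtain k where k: "k < 2 * n" "u = vs ! k" using edge_in_verts[OF assms] verts_nthE by metis
  obtain l where l: "l < 2 * n" "v = vs ! l" using edge_in_verts[OF assms] verts_nthE by metis
  have side: "vs ! i \<in> (!) vs ` {..<n} \<longleftrightarrow> i < n" if "i < 2 * n" for i
    using inj_on_image_mem_iff[OF inj_nth_vs, of i "{..<n}"] that by auto
  have nz: "bipartite_adj_mat M $$ (k, l) \<noteq> 0" using k l assms by (simp add: A_nonzero_iff)
  have "k < n \<longleftrightarrow> \<not> l < n"
    using k(1)
  proof (cases rule: less_double_cases)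
    case left
    then show ?thesis using left_nonzero_iff[of k l] nz l by simp
  next
    case (right i)
    then show ?thesis using right_nonzero_iff[of i l] nz l by simp
  qed
  then show ?thesis using side k l by simp
qed

lemma bipartite: "bipartite_sgraph G"
proof -
  let ?X = "(!) vs ` {..<n}" and ?Y = "verts G - (!) vs ` {..<n}"
  have "?X \<subseteq> verts G" using nth_vs_in by auto
  then have "?X \<union> ?Y = verts G" by blast
  moreover have "\<exists>x\<in>?X. \<exists>y\<in>?Y. e = {x, y}" if e: "e \<in> edges G" for e
  proof -
    obtain i j where e': "i < 2 * n" "j < 2 * n" "e = {vs ! i, vs ! j}"
      by (rule edge_nthE[OF e])
    then have s: "vs ! i \<in> ?X \<longleftrightarrow> vs ! j \<notin> ?X" using edge_sides e by simp
    have "vs ! i \<in> verts G" "vs ! j \<in> verts G" using e' nth_vs_in by simp_all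
    show ?thesis
    proof (cases "vs ! i \<in> ?X")
      case True
      then show ?thesis using s e' \<open>vs ! j \<in> verts G\<close> by (intro bexI[of _ "vs ! i"] bexI[of _ "vs ! j"]) auto
    next
      case False
      then show ?thesis using s e' \<open>vs ! i \<in> verts G\<close>
        by (intro bexI[of _ "vs ! j"] bexI[of _ "vs ! i"]) (auto simp: insert_commute)
    qed
  qed
  ultimately show ?thesis
    unfolding bipartite_sgraph_def by (intro exI[of _ ?X] exI[of _ ?Y] conjI ballI) auto
qed

lemma triangle_free: "triangle_free G"
  unfolding triangle_free_def using edge_sides by metis

lemma SR2SE:
  assumes good: "proper02 n r M" and n: "0 < n" and r: "0 < r"
  shows "SR2SE (2 * n) r G"
proof -
  note w = proper02_weighing[OF good]
  have "connected_sgraph G"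
    using good n unfolding connected_iff_splits proper02_def proper_weighing_matrix_iff[OF w r] by blast
  moreover have "card (neighbours G u \<inter> neighbours G v) \<in> {0, 2}"
    if uv: "u \<in> verts G" "v \<in> verts G" "u \<noteq> v" for u v
  proof -
    obtain k where k: "k < 2 * n" "u = vs ! k" using uv(1) by (rule verts_nthE)
    obtain l where l: "l < 2 * n" "v = vs ! l" using uv(2) by (rule verts_nthE)
    have kl: "k \<noteq> l" using k l uv by auto
    have rows: "card {c. c < n \<and> M $$ (a, c) \<noteq> 0 \<and> M $$ (b, c) \<noteq> 0} \<in> {0, 2}"
      if "a < n" "b < n" "a \<noteq> b" for a b
      using good that unfolding proper02_def rows_intersect_0_or_2_iff[OF carrier_M] by blast
    \<comment> \<open>The first \<open>n\<close> positions are columns of \<open>M\<close>, about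
      which the overlap condition on rows says nothing directly; the transposed matrix covers
      them.\<close>
    have cols: "card {c. c < n \<and> M $$ (c, a) \<noteq> 0 \<and> M $$ (c, b) \<noteq> 0} \<in> {0, 2}"
      if "a < n" "b < n" "a \<noteq> b" for a b
    proof -
      have "{c. c < n \<and> M $$ (c, a) \<noteq> 0 \<and> M $$ (c, b) \<noteq> 0} =
          {c. c < n \<and> transpose_mat M $$ (a, c) \<noteq> 0 \<and> transpose_mat M $$ (b, c) \<noteq> 0}"
        using that carrier_M by auto
      moreover have "transpose_mat M \<in> carrier_mat n n" using carrier_M by simp
      then have "card {c. c < n \<and> transpose_mat M $$ (a, c) \<noteq> 0 \<and> transpose_mat M $$ (b, c) \<noteq> 0} \<in> {0, 2}"
        using proper02_transpose[OF good r] that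
        by (simp only: proper02_def rows_intersect_0_or_2_iff not_False_eq_True)
      ultimately show ?thesis by (simp only:)
    qed
    from k(1) show ?thesis
    proof (cases rule: less_double_cases)
      case left
      from l(1) show ?thesis
        by (cases rule: less_double_cases)
          (use k l kl left cols card_common_left card_common_mixed in simp_all)
    next
      case (right i)
      from l(1) show ?thesis
        by (cases rule: less_double_cases)
          (use k l kl right rows card_common_right card_common_mixed in \<open>simp_all add: Int_commute\<close>)
    qed
  qed
  ultimately have "signed_rectagraph G"
    unfolding signed_rectagraph_def signed_02_graph_def using signed triangle_free by blast
  moreover have "regular_sgraph r G"
    unfolding regular_iff
    using weighing_matrix_col_card[OF w] weighing_matrix_row_card[OF w r] by blast
  moreover have "sgraph_spectrum G = {sqrt (real r), - sqrt (real r)}"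
  proof -
    \<comment> \<open>\<open>sgraph_spectrum\<close> collects eigenvalues over all listings, so each
      adjacency matrix of \<open>G\<close> is treated, not only the block matrix.\<close>
    have "spectrum B = {sqrt (real r), - sqrt (real r)}" if B: "adjacency_matrix G B" for B
    proof -
      obtain ws where "listed_sgraph G ws (card (verts G)) B" using B signed by (rule adjacency_matrixE)
      then interpret W: listed_sgraph G ws "2 * n" B by (simp add: card_verts)
      have "B * B = real r \<cdot>\<^sub>m 1\<^sub>m (2 * n)"
        using adjacency_matrix_switching_equiv[OF signed adjacency B] bipartite_adj_mat_square[OF w r]
        unfolding card_verts by (rule switching_equiv_square)
      then show ?thesis
        using W.carrier_A W.A_diag[of 0] n r by (intro spectrum_of_square_root) auto
    qed
    then show ?thesis unfolding sgraph_spectrum_def using adjacency by auto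
  qed
  moreover have "sqrt (real r) \<noteq> - sqrt (real r)" using r by simp
  ultimately show ?thesis unfolding SR2SE_def using card_verts by blast
qed

end

section \<open>Switching classes and equivalence classes\<close>

lemma bij_betw_lessThanI:
  fixes f :: "nat \<Rightarrow> nat"
  assumes "\<And>i. i < m \<Longrightarrow> f i < m" "\<And>i j. i < m \<Longrightarrow> j < m \<Longrightarrow> f i = f j \<Longrightarrow> i = j"
  shows "bij_betw f {..<m} {..<m}"
proof -
  have "inj_on f {..<m}" using assms(2) by (auto intro: inj_onI)
  moreover have "f ` {..<m} \<subseteq> {..<m}" using assms(1) by auto
  ultimately show ?thesis by (simp add: bij_betw_def endo_inj_surj)
qed

text \<open>If \<open>M = P * N * Q\<close>, the block matrix of \<open>N\<close> is switched by the
  block diagonal matrix of \<open>Q\<close> and the transpose of \<open>P\<close>. Accordingly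
  \<open>f\<close> and \<open>u\<close> use the column data \<open>q\<close>, \<open>t\<close> on
  the first half and the row data \<open>p\<close>, \<open>s\<close>, shifted by \<open>n\<close>,
  on the second.\<close>

lemma switching_equiv_bipartite_adj_mat:
  assumes N: "N \<in> carrier_mat n n" and MN: "weighing_equivalent n M N"
  shows "switching_equiv (2 * n) (bipartite_adj_mat N) (bipartite_adj_mat M)"
proof -
  obtain p q s t where M: "M \<in> carrier_mat n n"
    and p: "bij_betw p {..<n} {..<n}" and q: "bij_betw q {..<n} {..<n}"
    and s: "s \<in> {..<n} \<rightarrow> {1, -1}" and t: "t \<in> {..<n} \<rightarrow> {1, -1}"
    and eq: "\<forall>i<n. \<forall>j<n. M $$ (i, j) = s i * t j * N $$ (p i, q j)"
    using MN N by (rule weighing_equivalentE)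
  have lt: "p i < n" "q i < n" if "i < n" for i using p q that by (auto dest: bij_betwE)
  have inj: "p i = p j \<Longrightarrow> i = j" "q i = q j \<Longrightarrow> i = j" if "i < n" "j < n" for i j
    using inj_onD[OF bij_betw_imp_inj_on[OF p], of i j] inj_onD[OF bij_betw_imp_inj_on[OF q], of i j] that
    by auto
  define f where "f = (\<lambda>a. if a < n then q a else n + p (a - n))"
  define u where "u = (\<lambda>a. if a < n then t a else s (a - n))"
  have "bij_betw f {..<2 * n} {..<2 * n}"
  proof (rule bij_betw_lessThanI)
    fix a assume "a < 2 * n"
    then show "f a < 2 * n" by (cases rule: less_double_cases) (use lt in \<open>auto simp: f_def less_double\<close>)
  next
    fix a b assume ab: "a < 2 * n" "b < 2 * n" "f a = f b"
    from ab(1) show "a = b"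
    proof (cases rule: less_double_cases)
      case left
      from ab(2) show ?thesis
        by (cases rule: less_double_cases) (use left ab(3) lt(2)[of a] inj(2)[of a b] in \<open>simp_all add: f_def\<close>)
    next
      case (right i)
      from ab(2) show ?thesis
      proof (cases rule: less_double_cases)
        case left
        then show ?thesis using right ab(3) lt(2)[of b] by (simp add: f_def)
      next
        case (right k)
        then show ?thesis using \<open>a = n + i\<close> \<open>i < n\<close> ab(3) inj(1)[of i k] by (simp add: f_def)
      qed
    qed
  qed
  moreover have "u \<in> {..<2 * n} \<rightarrow> {1, -1}"
  proof
    fix a assume "a \<in> {..<2 * n}"
    then have "a < 2 * n" by simp
    then show "u a \<in> {1, -1}" by (cases rule: less_double_cases) (use s t in \<open>auto simp: u_def\<close>)
  qed
  moreover have "bipartite_adj_mat M $$ (a, b) = u a * u b * bipartite_adj_mat N $$ (f a, f b)"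
    if ab: "a < 2 * n" "b < 2 * n" for a b
    using ab(1)
  proof (cases rule: less_double_cases)
    case left
    from ab(2) show ?thesis
      by (cases rule: less_double_cases)
        (use left eq lt in \<open>simp_all add: f_def u_def index_bipartite_adj_mat[OF M] index_bipartite_adj_mat[OF N]\<close>)
  next
    case (right i)
    from ab(2) show ?thesis
      by (cases rule: less_double_cases)
        (use right eq lt in \<open>simp_all add: f_def u_def index_bipartite_adj_mat[OF M] index_bipartite_adj_mat[OF N]\<close>)
  qed
  ultimately show ?thesis
    by (rule switching_equivI[OF bipartite_adj_mat_carrier[OF N] bipartite_adj_mat_carrier[OF M]])
qed

text \<open>Interchanging the two halves of the listing. This is why a switching class cannot tell a
  matrix from its transpose.\<close>

lemma switching_equiv_bipartite_adj_mat_transpose: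
  assumes M: "M \<in> carrier_mat n n"
  shows "switching_equiv (2 * n) (bipartite_adj_mat M) (bipartite_adj_mat (transpose_mat M))"
proof -
  have MT: "transpose_mat M \<in> carrier_mat n n" using M by simp
  define f where "f = (\<lambda>a. if a < n then n + a else a - n)"
  have bij: "bij_betw f {..<2 * n} {..<2 * n}"
    by (rule bij_betw_lessThanI) (auto simp: f_def split: if_splits)
  have one: "(\<lambda>_. 1 :: real) \<in> {..<2 * n} \<rightarrow> {1, -1}" by simp
  show ?thesis
  proof (rule switching_equivI[OF bipartite_adj_mat_carrier[OF M] bipartite_adj_mat_carrier[OF MT] bij one])
    fix a b assume ab: "a < 2 * n" "b < 2 * n"
    from ab(1) show "bipartite_adj_mat (transpose_mat M) $$ (a, b) = 1 * 1 * bipartite_adj_mat M $$ (f a, f b)"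
    proof (cases rule: less_double_cases)
      case left
      from ab(2) show ?thesis
        by (cases rule: less_double_cases)
          (use left M in \<open>simp_all add: f_def index_bipartite_adj_mat[OF M] index_bipartite_adj_mat[OF MT]\<close>)
    next
      case (right i)
      from ab(2) show ?thesis
        by (cases rule: less_double_cases)
          (use right M in \<open>simp_all add: f_def index_bipartite_adj_mat[OF M] index_bipartite_adj_mat[OF MT]\<close>)
    qed
  qed
qed

text \<open>Every nonzero entry of \<open>N\<close> joins the two sides, so the rows and columns whose side is
  preserved split \<open>N\<close>; hence the permutation preserves both sides or exchanges them.\<close>

lemma switching_equiv_bipartite_adj_matD:
  assumes M: "M \<in> carrier_mat n n" and N: "N \<in> carrier_mat n n"
    and nsp: "\<And>R C. splits n N R C \<Longrightarrow> R = {} \<and> C = {} \<or> R = {..<n} \<and> C = {..<n}"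
    and sw: "switching_equiv (2 * n) (bipartite_adj_mat M) (bipartite_adj_mat N)"
  shows "weighing_equivalent n N M \<or> weighing_equivalent n N (transpose_mat M)"
proof -
  obtain p s where "bipartite_adj_mat M \<in> carrier_mat (2 * n) (2 * n)"
    "bipartite_adj_mat N \<in> carrier_mat (2 * n) (2 * n)"
    and p: "bij_betw p {..<2 * n} {..<2 * n}" and s: "s \<in> {..<2 * n} \<rightarrow> {1, -1}"
    and eq: "\<forall>i<2 * n. \<forall>j<2 * n.
      bipartite_adj_mat N $$ (i, j) = s i * s j * bipartite_adj_mat M $$ (p i, p j)"
    using sw by (rule switching_equivE)
  have lt: "p i < 2 * n" if "i < 2 * n" for i using p that by (auto dest: bij_betwE)
  have inj: "i = j" if "p i = p j" "i < 2 * n" "j < 2 * n" for i j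
    using inj_onD[OF bij_betw_imp_inj_on[OF p] that(1)] that by simp
  have N_eq: "N $$ (i, j) = s (n + i) * s j * bipartite_adj_mat M $$ (p (n + i), p j)"
    if "i < n" "j < n" for i j
    using eq that index_bipartite_adj_mat(3)[OF N that] by simp
  define R C where "R = {i. i < n \<and> \<not> p (n + i) < n}" and "C = {j. j < n \<and> p j < n}"
  have "splits n N R C"
    unfolding splits_def
  proof (intro conjI allI impI)
    fix i j assume ij: "i < n" "j < n" and "N $$ (i, j) \<noteq> 0"
    then have nz: "bipartite_adj_mat M $$ (p (n + i), p j) \<noteq> 0" using N_eq by auto
    have "p (n + i) < 2 * n" "p j < 2 * n" using lt ij by simp_all
    then have "\<not> p (n + i) < n \<longleftrightarrow> p j < n"
      using nz by (elim less_double_cases) (auto simp: index_bipartite_adj_mat[OF M])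
    then show "i \<in> R \<longleftrightarrow> j \<in> C" using ij by (simp add: R_def C_def)
  qed (auto simp: R_def C_def)
  then consider "R = {}" "C = {}" | "R = {..<n}" "C = {..<n}" using nsp by blast
  then show ?thesis
  proof cases
    \<comment> \<open>No position keeps its side: rows of \<open>N\<close> go to columns of
      \<open>M\<close> and columns to rows, hence the transpose. Subtracting \<open>n\<close> turns
      a row position into a row index.\<close>
    case 1
    then have side: "p (n + i) < n" "\<not> p i < n" if "i < n" for i using that by (auto simp: R_def C_def)
    have ge: "n \<le> p i" "p i < 2 * n" if "i < n" for i using side(2)[OF that] lt[of i] that by simp_all
    have MT: "transpose_mat M \<in> carrier_mat n n" using M by simp
    have row: "bij_betw (\<lambda>j. p j - n) {..<n} {..<n}"
    proof (rule bij_betw_lessThanI)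
      fix i j assume ij: "i < n" "j < n" "p i - n = p j - n"
      then have "p i = p j" using ge[of i] ge[of j] by linarith
      then show "i = j" using inj ij by simp
    next
      fix i assume "i < n"
      then show "p i - n < n" using ge[of i] by simp
    qed
    have col: "bij_betw (\<lambda>i. p (n + i)) {..<n} {..<n}"
    proof (rule bij_betw_lessThanI)
      fix i j assume "i < n" "j < n" "p (n + i) = p (n + j)"
      then show "i = j" using inj[of "n + i" "n + j"] by simp
    qed (rule side)
    have sr: "(\<lambda>i. s (n + i)) \<in> {..<n} \<rightarrow> {1, -1}" and sc: "s \<in> {..<n} \<rightarrow> {1, -1}"
      using s by (auto simp: Pi_iff)
    have "weighing_equivalent n N (transpose_mat M)"
    proof (rule weighing_equivalentI[OF N MT col row sr sc])
      fix i j assume ij: "i < n" "j < n"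
      have "p j = n + (p j - n)" "p j - n < n" using ge[OF ij(2)] by simp_all
      then have "bipartite_adj_mat M $$ (p (n + i), p j) = M $$ (p j - n, p (n + i))"
        using index_bipartite_adj_mat(2)[OF M, of "p (n + i)" "p j - n"] side ij by simp
      then show "N $$ (i, j) = s (n + i) * s j * transpose_mat M $$ (p (n + i), p j - n)"
        using N_eq[OF ij] M side ij \<open>p j - n < n\<close> by simp
    qed
    then show ?thesis ..
  next
    \<comment> \<open>Every position keeps its side, so \<open>p\<close> restricts to the columns
      and, after the shift by \<open>n\<close>, to the rows.\<close>
    case 2
    then have side: "\<not> p (n + i) < n" "p i < n" if "i < n" for i using that by (auto simp: R_def C_def)
    have ge: "n \<le> p (n + i)" "p (n + i) < 2 * n" if "i < n" for i using side(1)[OF that] lt[of "n + i"] that by simp_all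
    have row: "bij_betw (\<lambda>i. p (n + i) - n) {..<n} {..<n}"
    proof (rule bij_betw_lessThanI)
      fix i j assume ij: "i < n" "j < n" "p (n + i) - n = p (n + j) - n"
      then have "p (n + i) = p (n + j)" using ge[of i] ge[of j] by linarith
      then show "i = j" using inj[of "n + i" "n + j"] ij by simp
    next
      fix i assume "i < n"
      then show "p (n + i) - n < n" using ge[of i] by simp
    qed
    have col: "bij_betw p {..<n} {..<n}"
    proof (rule bij_betw_lessThanI)
      fix i j assume "i < n" "j < n" "p i = p j"
      then show "i = j" using inj[of i j] by simp
    qed (rule side)
    have sr: "(\<lambda>i. s (n + i)) \<in> {..<n} \<rightarrow> {1, -1}" and sc: "s \<in> {..<n} \<rightarrow> {1, -1}"
      using s by (auto simp: Pi_iff)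
    have "weighing_equivalent n N M"
    proof (rule weighing_equivalentI[OF N M row col sr sc])
      fix i j assume ij: "i < n" "j < n"
      have "p (n + i) = n + (p (n + i) - n)" "p (n + i) - n < n" using ge[OF ij(1)] by simp_all
      then have "bipartite_adj_mat M $$ (p (n + i), p j) = M $$ (p (n + i) - n, p j)"
        using index_bipartite_adj_mat(3)[OF M, of "p (n + i) - n" "p j"] side ij by simp
      then show "N $$ (i, j) = s (n + i) * s j * M $$ (p (n + i) - n, p j)"
        using N_eq[OF ij] by simp
    qed
    then show ?thesis ..
  qed
qed

text \<open>The infinite vertex type supplies \<open>m\<close> distinct vertices for any
  \<open>m\<close>. Symmetry and zero diagonal are what a simple undirected graph requires.\<close>

lemma sgraph_with_adjacency_matrix:
  assumes A: "A \<in> carrier_mat m m"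
    and ent: "\<And>i j. i < m \<Longrightarrow> j < m \<Longrightarrow> A $$ (i, j) \<in> {0, 1, -1}"
    and sym: "\<And>i j. i < m \<Longrightarrow> j < m \<Longrightarrow> A $$ (i, j) = A $$ (j, i)"
    and diag: "\<And>i. i < m \<Longrightarrow> A $$ (i, i) = 0"
  obtains G :: "'a::infinite sgraph" where "signed_graph G" "adjacency_matrix G A"
proof -
  obtain V :: "'a set" where V: "finite V" "card V = m"
    using infinite_arbitrarily_large[OF infinite_UNIV, of m] by blast
  obtain vs where vs: "set vs = V" "distinct vs" using finite_distinct_list[OF V(1)] by blast
  then have len: "length vs = m" using V(2) distinct_card[OF vs(2)] by simp
  have nth: "vs ! i = vs ! j \<longleftrightarrow> i = j" if "i < m" "j < m" for i j
    using that vs len nth_eq_iff_index_eq by metis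
  define ix where "ix = inv_into {..<m} ((!) vs)"
  have ix: "ix (vs ! i) = i" if "i < m" for i
    unfolding ix_def using that nth by (intro inv_into_f_f) (auto intro: inj_onI)
  \<comment> \<open>\<open>sign\<close> takes an unordered edge, so its two ends are put in some
    order by choice; symmetry of \<open>A\<close> makes the order irrelevant.\<close>
  define \<sigma> where "\<sigma> = (\<lambda>e. A $$ (let x = SOME x. x \<in> e; y = SOME y. e = {x, y} in (ix x, ix y)))"
  define G where "G = \<lparr>verts = V,
    edges = {e. \<exists>i j. i < m \<and> j < m \<and> e = {vs ! i, vs ! j} \<and> A $$ (i, j) \<noteq> 0}, sign = \<sigma>\<rparr>"
  have \<sigma>: "\<sigma> {vs ! i, vs ! j} = A $$ (i, j)" if ij: "i < m" "j < m" for i j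
  proof -
    let ?e = "{vs ! i, vs ! j}"
    define x where "x = (SOME x. x \<in> ?e)"
    define y where "y = (SOME y. ?e = {x, y})"
    have "x \<in> ?e" unfolding x_def by (rule someI[of _ "vs ! i"]) simp
    then have "\<exists>y. ?e = {x, y}" by auto
    then have "?e = {x, y}" unfolding y_def by (rule someI_ex)
    then have "x = vs ! i \<and> y = vs ! j \<or> x = vs ! j \<and> y = vs ! i" by (auto simp: doubleton_eq_iff)
    then have "A $$ (ix x, ix y) = A $$ (i, j)" using ix ij sym by auto
    then show ?thesis by (simp add: \<sigma>_def x_def y_def Let_def)
  qed
  have edge: "{vs ! i, vs ! j} \<in> edges G \<longleftrightarrow> A $$ (i, j) \<noteq> 0" if ij: "i < m" "j < m" for i j
  proof
    assume "{vs ! i, vs ! j} \<in> edges G"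
    then obtain k l where kl: "k < m" "l < m" "{vs ! i, vs ! j} = {vs ! k, vs ! l}" "A $$ (k, l) \<noteq> 0"
      by (auto simp: G_def)
    then have "i = k \<and> j = l \<or> i = l \<and> j = k" using ij by (auto simp: doubleton_eq_iff nth)
    then show "A $$ (i, j) \<noteq> 0" using kl sym[of k l] by auto
  qed (use ij in \<open>auto simp: G_def\<close>)
  have "signed_graph G"
    unfolding signed_graph_def
  proof (intro conjI ballI)
    fix e assume "e \<in> edges G"
    then obtain i j where ij: "i < m" "j < m" and e: "e = {vs ! i, vs ! j}" and nz: "A $$ (i, j) \<noteq> 0"
      by (auto simp: G_def)
    then have "i \<noteq> j" using diag by auto
    then show "card e = 2" using nth ij by (simp add: e)
    show "e \<subseteq> verts G" using ij vs len by (auto simp: e G_def)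
    show "sign G e \<in> {1, -1}" using ent[OF ij] nz \<sigma>[OF ij] by (auto simp: G_def e)
  qed (use V in \<open>simp add: G_def\<close>)
  moreover have "A = adj_mat_of_list G vs"
  proof (rule eq_matI)
    fix i j assume "i < dim_row (adj_mat_of_list G vs)" "j < dim_col (adj_mat_of_list G vs)"
    then have "i < m" "j < m" by (simp_all add: adj_mat_of_list_def len)
    then show "A $$ (i, j) = adj_mat_of_list G vs $$ (i, j)"
      using edge \<sigma> by (simp add: adj_mat_of_list_def len) (simp add: G_def)
  qed (use A len in \<open>simp_all add: adj_mat_of_list_def\<close>)
  then have "adjacency_matrix G A" using vs unfolding adjacency_matrix_def by (auto simp: G_def)
  ultimately show thesis by (rule that)
qed

lemma sgraph_with_bipartite_adj_mat:
  assumes w: "weighing_matrix n r M"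
  obtains G :: "'a::infinite sgraph" where "signed_graph G" "adjacency_matrix G (bipartite_adj_mat M)"
proof (rule sgraph_with_adjacency_matrix)
  have M: "M \<in> carrier_mat n n" by (rule weighing_matrix_carrier[OF w])
  note idx = index_bipartite_adj_mat[OF M]
  show "bipartite_adj_mat M \<in> carrier_mat (2 * n) (2 * n)" by (rule bipartite_adj_mat_carrier[OF M])
  have ent: "M $$ (i, j) \<in> {0, 1, -1}" if "i < n" "j < n" for i j
    using w that by (simp add: weighing_matrix_def)
  show "bipartite_adj_mat M $$ (i, j) \<in> {0, 1, -1}" if "i < 2 * n" "j < 2 * n" for i j
    using that ent by (elim less_double_cases) (simp_all add: idx)
  show "bipartite_adj_mat M $$ (i, j) = bipartite_adj_mat M $$ (j, i)" if "i < 2 * n" "j < 2 * n" for i j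
    using that by (elim less_double_cases) (simp_all add: idx)
  show "bipartite_adj_mat M $$ (i, i) = 0" if "i < 2 * n" for i
    using that by (elim less_double_cases) (simp_all add: idx)
qed (rule that)

lemma adjacency_bipartite_listing:
  assumes G: "signed_graph G" and A: "adjacency_matrix G (bipartite_adj_mat M)"
    and M: "M \<in> carrier_mat n n"
  obtains vs where "bipartite_listing G vs n M"
proof -
  obtain vs where "listed_sgraph G vs (card (verts G)) (bipartite_adj_mat M)"
    using A G by (rule adjacency_matrixE)
  then interpret listed_sgraph G vs "card (verts G)" "bipartite_adj_mat M" .
  have "card (verts G) = 2 * n" using carrier_A bipartite_adj_mat_carrier[OF M] by auto
  then have "listed_sgraph G vs (2 * n) (bipartite_adj_mat M)" using listed_sgraph_axioms by simp
  then show thesis using that M by (simp add: bipartite_listing_def bipartite_listing_axioms_def)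
qed

text \<open>The way back from graphs to matrices. Listing one colour class before the other gives
  the block form, the two eigenvalues give the weighing identity, and connectedness gives
  properness.\<close>

lemma bipartite_SR2SE_listing:
  assumes sr: "SR2SE (2 * n) r G" and bip: "bipartite_sgraph G" and n: "0 < n" and r: "0 < r"
  obtains vs M where "bipartite_listing G vs n M" "proper02 n r M"
proof -
  have G: "signed_graph G" and con: "connected_sgraph G" and card_G: "card (verts G) = 2 * n"
    and reg: "regular_sgraph r G"
    and nb02: "\<And>u v. u \<in> verts G \<Longrightarrow> v \<in> verts G \<Longrightarrow> u \<noteq> v \<Longrightarrow>
      card (neighbours G u \<inter> neighbours G v) \<in> {0, 2}"
    using sr by (auto simp: SR2SE_def signed_rectagraph_def signed_02_graph_def)
  obtain \<theta> where spec: "sgraph_spectrum G = {\<theta>, -\<theta>}" using sr by (auto simp: SR2SE_def)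
  obtain X Y where XY: "X \<union> Y = verts G" "X \<inter> Y = {}"
    and ed: "\<forall>e\<in>edges G. \<exists>x\<in>X. \<exists>y\<in>Y. e = {x, y}"
    using bip by (auto simp: bipartite_sgraph_def)
  have sides: "u \<in> X \<longleftrightarrow> v \<in> Y" "u \<in> Y \<longleftrightarrow> v \<in> X" if "{u, v} \<in> edges G" for u v
  proof -
    obtain x y where "x \<in> X" "y \<in> Y" "{u, v} = {x, y}" using ed \<open>{u, v} \<in> edges G\<close> by blast
    moreover from this have "x \<notin> Y" "y \<notin> X" using XY(2) by blast+
    ultimately show "u \<in> X \<longleftrightarrow> v \<in> Y" "u \<in> Y \<longleftrightarrow> v \<in> X" by (auto simp: doubleton_eq_iff)
  qed
  have fin: "finite X" "finite Y" using G XY(1) by (auto simp: signed_graph_def intro: finite_subset)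
  have deg: "card (neighbours G v) = r" if "v \<in> X \<union> Y" for v
    using reg that XY(1) by (simp add: regular_sgraph_def)
  have nbX: "card {y \<in> Y. {x, y} \<in> edges G} = r" if "x \<in> X" for x
  proof -
    have "neighbours G x = {y \<in> Y. {x, y} \<in> edges G}"
      using that sides XY by (auto simp: neighbours_def)
    then show ?thesis using deg[of x] that by simp
  qed
  have nbY: "card {x \<in> X. {x, y} \<in> edges G} = r" if "y \<in> Y" for y
  proof -
    have "neighbours G y = {x \<in> X. {x, y} \<in> edges G}"
      using that sides XY by (auto simp: neighbours_def insert_commute)
    then show ?thesis using deg[of y] that by simp
  qed
  \<comment> \<open>Counting the edges from both sides gives \<open>r * card X = r * card Y\<close>.
    Since \<open>r\<close> is positive the colour classes have equal size, which makes
    \<open>M\<close> square.\<close>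
  have "(\<Sum>x\<in>X. card {y \<in> Y. {x, y} \<in> edges G}) = r * card Y"
    using nbY by (intro sum_multicount fin) simp
  then have "card X = card Y" using nbX r by simp
  moreover have "card X + card Y = 2 * n" using card_Un_disjoint[OF fin XY(2)] XY(1) card_G by simp
  ultimately have card_XY: "card X = n" "card Y = n" by simp_all
  obtain xs where xs: "set xs = X" "distinct xs" using finite_distinct_list[OF fin(1)] by blast
  obtain ys where ys: "set ys = Y" "distinct ys" using finite_distinct_list[OF fin(2)] by blast
  have len: "length xs = n" "length ys = n"
    using xs ys card_XY distinct_card[OF xs(2)] distinct_card[OF ys(2)] by simp_all
  \<comment> \<open>\<open>X\<close> comes first and therefore indexes the columns of
    \<open>M\<close>. The opposite order would produce the transpose.\<close>
  define vs where "vs = xs @ ys"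
  define A where "A = adj_mat_of_list G vs"
  have "distinct vs" using xs ys XY(2) by (simp add: vs_def)
  moreover have "set vs = verts G" using xs ys XY(1) by (simp add: vs_def)
  moreover have "length vs = 2 * n" using len by (simp add: vs_def)
  ultimately interpret L: listed_sgraph G vs "2 * n" A
    using G by (simp add: listed_sgraph_def A_def)
  have left: "vs ! i \<in> X" if "i < n" for i using that xs len by (auto simp: vs_def nth_append)
  have right: "vs ! (n + i) \<in> Y" if "i < n" for i using that ys len by (auto simp: vs_def nth_append)
  define M where "M = mat n n (\<lambda>(i, j). A $$ (n + i, j))"
  have M: "M \<in> carrier_mat n n" by (simp add: M_def)
  have M_entry: "A $$ (n + i, j) = M $$ (i, j)" "A $$ (j, n + i) = M $$ (i, j)" if "i < n" "j < n" for i j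
    using that L.A_sym[of j "n + i"] by (simp_all add: M_def)
  note idx = index_bipartite_adj_mat[OF M]
  have z: "A $$ (i, j) = 0" "A $$ (n + i, n + j) = 0" if "i < n" "j < n" for i j
  proof -
    have "vs ! j \<notin> Y" "vs ! (n + i) \<notin> X" using left[of j] right[of i] XY(2) that by blast+
    then have "{vs ! i, vs ! j} \<notin> edges G" "{vs ! (n + i), vs ! (n + j)} \<notin> edges G"
      using sides(1)[of "vs ! i" "vs ! j"] sides(1)[of "vs ! (n + i)" "vs ! (n + j)"]
        left[of i] right[of j] that
      by blast+
    then show "A $$ (i, j) = 0" "A $$ (n + i, n + j) = 0" using that by (simp_all add: L.index_A)
  qed
  have A_eq: "A = bipartite_adj_mat M"
  proof (rule eq_matI)
    fix i j assume "i < dim_row (bipartite_adj_mat M)" "j < dim_col (bipartite_adj_mat M)"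
    then have "i < 2 * n" "j < 2 * n" using bipartite_adj_mat_carrier[OF M] by auto
    then show "A $$ (i, j) = bipartite_adj_mat M $$ (i, j)"
      by (elim less_double_cases) (simp_all add: idx z M_entry)
  qed (use L.carrier_A bipartite_adj_mat_carrier[OF M] in auto)
  have "bipartite_listing G vs n M"
    using L.listed_sgraph_axioms M unfolding A_eq
    by (simp add: bipartite_listing_def bipartite_listing_axioms_def)
  then interpret bipartite_listing G vs n M .
  have "spectrum A \<subseteq> {\<theta>, -\<theta>}"
    using spec L.adjacency unfolding sgraph_spectrum_def by auto
  then have sq: "A * A = \<theta>\<^sup>2 \<cdot>\<^sub>m 1\<^sub>m (2 * n)"
    using symmetric_two_eigenvalues_square[OF L.carrier_A] L.A_sym by blast
  have MM: "(\<Sum>i<n. M $$ (i, j) * M $$ (i, k)) = (if j = k then \<theta>\<^sup>2 else 0)" if jk: "j < n" "k < n" for j k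
  proof -
    have "(A * A) $$ (j, k) = (\<Sum>l<n + n. A $$ (j, l) * A $$ (l, k))"
      using index_mult_mat_sum[OF L.carrier_A L.carrier_A, of j k] jk by (simp add: mult_2)
    also have "\<dots> = (\<Sum>i<n. M $$ (i, j) * M $$ (i, k))"
      unfolding sum_lessThan_add A_eq using jk by (simp add: idx)
    finally show ?thesis using jk by (cases "j = k") (simp_all add: sq)
  qed
  have ent: "M $$ (i, j) \<in> {0, 1, -1}" if "i < n" "j < n" for i j
    using L.A_entries[of "n + i" j] that by (simp add: M_entry)
  have "\<theta>\<^sup>2 = real (card {i. i < n \<and> M $$ (i, 0) \<noteq> 0})"
    using MM[OF n n] sum_squares_eq_card[of n "\<lambda>i. M $$ (i, 0)"] ent n by simp
  also have "\<dots> = real r" using reg n by (simp add: regular_iff)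
  \<comment> \<open>Column \<open>0\<close> exists because \<open>0 < n\<close>. Its squared length
    is \<open>\<theta>\<^sup>2\<close> by the matrix identity and \<open>r\<close> by regularity,
    which turns the identity into the weighing condition.\<close>
  finally have w: "weighing_matrix n r M" using MM M ent by (simp add: weighing_matrix_iff)
  have "rows_intersect_0_or_2 M"
    unfolding rows_intersect_0_or_2_iff[OF M]
  proof (intro allI impI)
    fix i k assume ik: "i < n" "k < n" "i \<noteq> k"
    have "vs ! (n + i) \<noteq> vs ! (n + k)" using inj_onD[OF inj_nth_vs, of "n + i" "n + k"] ik by auto
    then show "card {j. j < n \<and> M $$ (i, j) \<noteq> 0 \<and> M $$ (k, j) \<noteq> 0} \<in> {0, 2}"
      using nb02[of "vs ! (n + i)" "vs ! (n + k)"] nth_vs_in ik card_common_right[of i k] by simp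
  qed
  moreover have "proper_weighing_matrix n r M"
    unfolding proper_weighing_matrix_iff[OF w r] using con connected_iff_splits by blast
  ultimately have "proper02 n r M" by (simp add: proper02_def)
  then show thesis using that bipartite_listing_axioms by blast
qed

section \<open>Classes described by representatives, and their correspondence\<close>

lemma signed_graph_adjacency_matrix:
  assumes "signed_graph G"
  obtains A where "adjacency_matrix G A"
proof -
  have "finite (verts G)" using assms by (simp add: signed_graph_def)
  then obtain vs where "set vs = verts G" "distinct vs" using finite_distinct_list by blast
  then show thesis using that[of "adj_mat_of_list G vs"] by (auto simp: adjacency_matrix_def)
qed

lemma switching_isomorphic_sym:
  assumes G: "signed_graph G" and H: "signed_graph H" and GH: "switching_isomorphic G H"
  shows "switching_isomorphic H G"
proof -
  obtain A where A: "adjacency_matrix G A" by (rule signed_graph_adjacency_matrix[OF G])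
  obtain B where B: "adjacency_matrix H B" by (rule signed_graph_adjacency_matrix[OF H])
  have sw: "switching_equiv (card (verts G)) A B" using GH switching_isomorphic_iff[OF G A H B] by simp
  moreover have "switching_equiv (card (verts H)) B B" by (rule adjacency_matrix_switching_equiv[OF H B B])
  ultimately have "card (verts G) = card (verts H)" by (auto simp: switching_equiv_def)
  then show ?thesis using switching_isomorphic_iff[OF H B G A] switching_equiv_sym[OF sw] by simp
qed

lemma switching_isomorphic_trans:
  assumes G: "signed_graph G" and H: "signed_graph H" and K: "signed_graph K"
    and GH: "switching_isomorphic G H" and HK: "switching_isomorphic H K"
  shows "switching_isomorphic G K"
proof -
  obtain A where A: "adjacency_matrix G A" by (rule signed_graph_adjacency_matrix[OF G])
  obtain B where B: "adjacency_matrix H B" by (rule signed_graph_adjacency_matrix[OF H])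
  obtain C where C: "adjacency_matrix K C" by (rule signed_graph_adjacency_matrix[OF K])
  have sw: "switching_equiv (card (verts G)) A B" using GH switching_isomorphic_iff[OF G A H B] by simp
  moreover have sw': "switching_equiv (card (verts H)) B C"
    using HK switching_isomorphic_iff[OF H B K C] by simp
  ultimately have "card (verts G) = card (verts H)" by (auto simp: switching_equiv_def)
  then show ?thesis
    using switching_isomorphic_iff[OF G A K C] switching_equiv_trans[OF sw] sw' by simp
qed

lemma SR2SE_signed: "SR2SE m r G \<Longrightarrow> signed_graph G"
  by (simp add: SR2SE_def signed_rectagraph_def signed_02_graph_def)

lemma proper02_bipartite_SR2SE:
  assumes "proper02 n r M" "0 < n" "0 < r" "signed_graph G" "adjacency_matrix G (bipartite_adj_mat M)"
  shows "SR2SE (2 * n) r G" "bipartite_sgraph G"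
proof -
  obtain vs where "bipartite_listing G vs n M"
    using assms(4,5) proper02_carrier[OF assms(1)] by (rule adjacency_bipartite_listing)
  then interpret bipartite_listing G vs n M .
  show "SR2SE (2 * n) r G" "bipartite_sgraph G" using SR2SE assms bipartite by blast+
qed

definition switching_class :: "nat \<Rightarrow> nat \<Rightarrow> 'a sgraph \<Rightarrow> 'a sgraph set" where
  "switching_class n r G =
     {H. SR2SE (2 * n) r H \<and> bipartite_sgraph H \<and> switching_isomorphic G H}"

lemma bipartite_SR2SE_classes_iff:
  "S \<in> bipartite_SR2SE_classes (2 * n) r \<longleftrightarrow>
     (\<exists>G. SR2SE (2 * n) r G \<and> bipartite_sgraph G \<and> S = switching_class n r G)"
proof -
  have "{(G, H). SR2SE (2 * n) r G \<and> bipartite_sgraph G \<and> SR2SE (2 * n) r H \<and> bipartite_sgraph H \<and>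
      switching_isomorphic G H} `` {G} = switching_class n r G"
    if "SR2SE (2 * n) r G" "bipartite_sgraph G" for G :: "'a sgraph"
    using that by (auto simp: switching_class_def)
  then show ?thesis unfolding bipartite_SR2SE_classes_def quotient_def by auto
qed

definition equivalence_class :: "nat \<Rightarrow> real mat \<Rightarrow> real mat set" where
  "equivalence_class n M = {N. weighing_equivalent n N M}"

text \<open>The classes ask for some proper member and for the overlap condition on all members.
  Both conditions are invariant under equivalence, so they can be tested on one
  representative.\<close>

lemma proper_weighing_classes_02_iff:
  "C \<in> proper_weighing_classes_02 n r \<longleftrightarrow> (\<exists>M. proper02 n r M \<and> C = equivalence_class n M)"
proof -
  have cls: "{(M, N). weighing_matrix n r M \<and> weighing_matrix n r N \<and> weighing_equivalent n M N} `` {M} =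
      equivalence_class n M" if "weighing_matrix n r M" for M
    using that weighing_equivalent_sym weighing_matrix_equivalent weighing_matrix_carrier
    unfolding equivalence_class_def by blast
  show ?thesis
  proof
    assume C: "C \<in> proper_weighing_classes_02 n r"
    then obtain M where w: "weighing_matrix n r M" and CM: "C = equivalence_class n M"
      using cls unfolding proper_weighing_classes_02_def weighing_classes_def quotient_def by auto
    have "M \<in> carrier_mat n n" by (rule weighing_matrix_carrier[OF w])
    then have MC: "M \<in> C" by (simp add: CM equivalence_class_def weighing_equivalent_refl)
    obtain N where "N \<in> C" and N: "proper_weighing_matrix n r N"
      using C by (auto simp: proper_weighing_classes_02_def)
    then have "weighing_equivalent n M N"
      using \<open>M \<in> carrier_mat n n\<close> by (simp add: CM equivalence_class_def weighing_equivalent_sym)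
    then have "proper_weighing_matrix n r M" using N proper_weighing_matrix_equivalent by blast
    moreover have "rows_intersect_0_or_2 M" using C MC by (simp add: proper_weighing_classes_02_def)
    ultimately show "\<exists>M. proper02 n r M \<and> C = equivalence_class n M"
      using CM by (auto simp: proper02_def)
  next
    assume "\<exists>M. proper02 n r M \<and> C = equivalence_class n M"
    then obtain M where M: "proper02 n r M" and C: "C = equivalence_class n M" by blast
    note w = proper02_weighing[OF M]
    have "C \<in> weighing_classes n r"
      unfolding weighing_classes_def quotient_def using w cls[OF w] C by blast
    moreover have "M \<in> C"
      using proper02_carrier[OF M] by (simp add: C equivalence_class_def weighing_equivalent_refl)
    moreover have "proper02 n r N" if "N \<in> C" for N
      using proper02_equivalent[OF M] that by (simp add: C equivalence_class_def)
    ultimately show "C \<in> proper_weighing_classes_02 n r"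
      unfolding proper_weighing_classes_02_def proper02_def by blast
  qed
qed

lemma equivalence_class_eq_iff:
  assumes "M \<in> carrier_mat n n" "N \<in> carrier_mat n n"
  shows "equivalence_class n M = equivalence_class n N \<longleftrightarrow> weighing_equivalent n M N"
  using assms weighing_equivalent_refl[of M n] weighing_equivalent_sym weighing_equivalent_trans
  unfolding equivalence_class_def by blast

lemma transpose_equivalence_class:
  assumes M: "M \<in> carrier_mat n n"
  shows "transpose_mat ` equivalence_class n M = equivalence_class n (transpose_mat M)"
proof
  show "transpose_mat ` equivalence_class n M \<subseteq> equivalence_class n (transpose_mat M)"
    using weighing_equivalent_transpose[OF M] by (auto simp: equivalence_class_def)
  show "equivalence_class n (transpose_mat M) \<subseteq> transpose_mat ` equivalence_class n M"
  proof
    fix N assume "N \<in> equivalence_class n (transpose_mat M)"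
    then have "weighing_equivalent n (transpose_mat N) (transpose_mat (transpose_mat M))"
      using M by (intro weighing_equivalent_transpose) (auto simp: equivalence_class_def)
    then show "N \<in> transpose_mat ` equivalence_class n M"
      by (intro image_eqI[of _ _ "transpose_mat N"]) (simp_all add: equivalence_class_def)
  qed
qed

text \<open>Both halves of the correspondence are read off from this criterion. From left to right,
  a graph for \<open>M\<close> in the class of \<open>G\<close> gives a switching between the block
  matrices, which preserves or exchanges the sides. From right to left, each matrix equivalent to
  \<open>M\<close> is realised by a graph, which is then switching isomorphic to
  \<open>G\<close>.\<close>

lemma class_of_bipartite_graphs_iff:
  fixes G :: "'a::infinite sgraph"
  assumes M: "proper02 n r M" and N: "proper02 n r N" and n: "0 < n" and r: "0 < r"
    and G: "signed_graph G" and adj: "adjacency_matrix G (bipartite_adj_mat N)"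
  shows "class_of_bipartite_graphs (equivalence_class n M) (switching_class n r G) \<longleftrightarrow>
    weighing_equivalent n M N \<or> weighing_equivalent n M (transpose_mat N)"
proof
  note car = proper02_carrier[OF M] proper02_carrier[OF N]
  have G2n: "card (verts G) = 2 * n"
    using proper02_bipartite_SR2SE(1)[OF N n r G adj] by (simp add: SR2SE_def)
  {
    assume "class_of_bipartite_graphs (equivalence_class n M) (switching_class n r G)"
    moreover have "M \<in> equivalence_class n M"
      by (simp add: equivalence_class_def weighing_equivalent_refl[OF car(1)])
    ultimately obtain H where H: "H \<in> switching_class n r G" "adjacency_matrix H (bipartite_adj_mat M)"
      unfolding class_of_bipartite_graphs_def by blast
    then have "switching_equiv (2 * n) (bipartite_adj_mat N) (bipartite_adj_mat M)"
      using switching_isomorphic_iff[OF G adj _ H(2)] G2n SR2SE_signed by (auto simp: switching_class_def)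
    then show "weighing_equivalent n M N \<or> weighing_equivalent n M (transpose_mat N)"
      using M unfolding proper02_def proper_weighing_matrix_iff[OF proper02_weighing[OF M] r]
      by (intro switching_equiv_bipartite_adj_matD[OF car(2,1)]) blast+
  }
  assume MN: "weighing_equivalent n M N \<or> weighing_equivalent n M (transpose_mat N)"
  show "class_of_bipartite_graphs (equivalence_class n M) (switching_class n r G)"
    unfolding class_of_bipartite_graphs_def
  proof
    fix L assume "L \<in> equivalence_class n M"
    then have LM: "weighing_equivalent n L M" by (simp add: equivalence_class_def)
    have L: "proper02 n r L" by (rule proper02_equivalent[OF M LM])
    have NT: "transpose_mat N \<in> carrier_mat n n" using car(2) by simp
    have "weighing_equivalent n L N \<or> weighing_equivalent n L (transpose_mat N)"
      using MN weighing_equivalent_trans[OF car(2) LM] weighing_equivalent_trans[OF NT LM] by blast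
    then have sw: "switching_equiv (2 * n) (bipartite_adj_mat N) (bipartite_adj_mat L)"
      using switching_equiv_bipartite_adj_mat[OF car(2)] switching_equiv_bipartite_adj_mat[OF NT]
        switching_equiv_trans[OF switching_equiv_bipartite_adj_mat_transpose[OF car(2)]] by blast
    obtain H :: "'a sgraph" where H: "signed_graph H" "adjacency_matrix H (bipartite_adj_mat L)"
      using proper02_weighing[OF L] by (rule sgraph_with_bipartite_adj_mat)
    have "switching_isomorphic G H" using switching_isomorphic_iff[OF G adj H] sw G2n by simp
    then have "H \<in> switching_class n r G"
      using proper02_bipartite_SR2SE[OF L n r H] by (simp add: switching_class_def)
    then show "\<exists>H\<in>switching_class n r G. adjacency_matrix H (bipartite_adj_mat L)" using H(2) by blast
  qed
qed

theorem theorem3p5: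
  fixes n r :: nat
  assumes "0 < n" and "0 < r"
  shows "(\<forall>C \<in> proper_weighing_classes_02 n r.
            \<exists>!S :: 'a::infinite sgraph set.
              S \<in> bipartite_SR2SE_classes (2 * n) r \<and> class_of_bipartite_graphs C S)
       \<and> (\<forall>S \<in> (bipartite_SR2SE_classes (2 * n) r :: 'a sgraph set set).
            \<exists>C \<in> proper_weighing_classes_02 n r.
              {C' \<in> proper_weighing_classes_02 n r. class_of_bipartite_graphs C' S}
                = {C, transpose_mat ` C})"
proof (intro conjI ballI)
  fix C assume "C \<in> proper_weighing_classes_02 n r"
  then obtain M where M: "proper02 n r M" and C: "C = equivalence_class n M"
    unfolding proper_weighing_classes_02_iff by blast
  have MC: "M \<in> C" using weighing_equivalent_refl[OF proper02_carrier[OF M]]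
    by (simp add: C equivalence_class_def)
  obtain G :: "'a sgraph" where G: "signed_graph G" "adjacency_matrix G (bipartite_adj_mat M)"
    using proper02_weighing[OF M] by (rule sgraph_with_bipartite_adj_mat)
  note GM = proper02_bipartite_SR2SE[OF M assms G]
  show "\<exists>!S :: 'a sgraph set. S \<in> bipartite_SR2SE_classes (2 * n) r \<and> class_of_bipartite_graphs C S"
  proof (rule ex1I[of _ "switching_class n r G"])
    show "switching_class n r G \<in> bipartite_SR2SE_classes (2 * n) r \<and>
        class_of_bipartite_graphs C (switching_class n r G)"
      using GM class_of_bipartite_graphs_iff[OF M M assms G]
        weighing_equivalent_refl[OF proper02_carrier[OF M]]
      unfolding bipartite_SR2SE_classes_iff C by blast
  next
    fix S :: "'a sgraph set"
    assume S: "S \<in> bipartite_SR2SE_classes (2 * n) r \<and> class_of_bipartite_graphs C S"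
    then obtain G' where G': "SR2SE (2 * n) r G'" "S = switching_class n r G'"
      unfolding bipartite_SR2SE_classes_iff by blast
    obtain H where "H \<in> S" and adj: "adjacency_matrix H (bipartite_adj_mat M)"
      using S MC unfolding class_of_bipartite_graphs_def by blast
    then have H: "signed_graph H" "switching_isomorphic G' H"
      using G' SR2SE_signed by (auto simp: switching_class_def)
    \<comment> \<open>\<open>G\<close> and \<open>H\<close> share the adjacency matrix built from
      \<open>M\<close>, so they are switching isomorphic. Since \<open>H\<close> lies in
      \<open>S\<close>, this ties the class of \<open>G'\<close> to that of
      \<open>G\<close>.\<close>
    have "switching_equiv (card (verts G)) (bipartite_adj_mat M) (bipartite_adj_mat M)"
      by (rule adjacency_matrix_switching_equiv[OF G(1,2,2)])
    then have "switching_isomorphic G H" using switching_isomorphic_iff[OF G H(1) adj] by simp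
    then have iso: "switching_isomorphic G' G" "switching_isomorphic G G'"
      using switching_isomorphic_trans switching_isomorphic_sym G(1) H SR2SE_signed[OF G'(1)] by metis+
    then show "S = switching_class n r G"
      unfolding G'(2) switching_class_def
      using switching_isomorphic_trans[OF G(1) SR2SE_signed[OF G'(1)]]
        switching_isomorphic_trans[OF SR2SE_signed[OF G'(1)] G(1)] SR2SE_signed by blast
  qed
next
  fix S :: "'a sgraph set" assume "S \<in> bipartite_SR2SE_classes (2 * n) r"
  then obtain G where sr: "SR2SE (2 * n) r G" and bip: "bipartite_sgraph G"
    and S: "S = switching_class n r G"
    unfolding bipartite_SR2SE_classes_iff by blast
  obtain vs M where listing: "bipartite_listing G vs n M" and M: "proper02 n r M"
    using sr bip assms by (rule bipartite_SR2SE_listing)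
  interpret bipartite_listing G vs n M by (rule listing)
  \<comment> \<open>The listing decided which colour class comes first, so \<open>?C\<close> is one
    of two possible answers and its transposes form the other. The two coincide when
    \<open>M\<close> is equivalent to its transpose.\<close>
  let ?C = "equivalence_class n M"
  note MT = proper02_transpose[OF M assms(2)]
  have C: "?C \<in> proper_weighing_classes_02 n r"
    "transpose_mat ` ?C \<in> proper_weighing_classes_02 n r"
    unfolding transpose_equivalence_class[OF carrier_M] proper_weighing_classes_02_iff
    using M MT by blast+
  have "C' \<in> {?C, transpose_mat ` ?C} \<longleftrightarrow> class_of_bipartite_graphs C' S"
    if C': "C' \<in> proper_weighing_classes_02 n r" for C'
  proof -
    obtain N where N: "proper02 n r N" and "C' = equivalence_class n N"
      using C' unfolding proper_weighing_classes_02_iff by blast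
    then show ?thesis
      using class_of_bipartite_graphs_iff[OF N M assms signed adjacency]
        equivalence_class_eq_iff[OF proper02_carrier[OF N] carrier_M]
        equivalence_class_eq_iff[OF proper02_carrier[OF N] proper02_carrier[OF MT]]
      by (simp add: S transpose_equivalence_class[OF carrier_M])
  qed
  then have "{C' \<in> proper_weighing_classes_02 n r. class_of_bipartite_graphs C' S} = {?C, transpose_mat ` ?C}"
    using C by blast
  then show "\<exists>C \<in> proper_weighing_classes_02 n r.
      {C' \<in> proper_weighing_classes_02 n r. class_of_bipartite_graphs C' S} = {C, transpose_mat ` C}"
    using C(1) by blast
qed

end
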